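(* Let $\gamma\in(0,1]$, $A\ge0$, $B\in[0,1]$, and let $n\ge1$ be an integer with $\gamma(n+1)>1$. Let $X:\mathcal{A}_n\mathcal{T}_{\mathcal{L}}\to\mathcal{C}_2^+$ be a partial homomorphism satisfying $\delta X^\sigma=X^{\Delta'(\sigma)}$ for all $\sigma\in\mathcal{A}_n\mathcal{T}_{\mathcal{L}}$ and $$\|X^\tau\|_{\gamma|\tau|}\le B\,A^{|\tau|}\,q_\gamma(\tau)\qquad\text{for all trees }\tau\in\mathcal{T}_{\mathcal{L}}\text{ with }|\tau|\le n.$$ Then there exists a unique extension of $X$ to a branched rough path defined on the whole of $\mathcal{A}\mathcal{T}_{\mathcal{L}}$ with roughness $\gamma$ and such that $$\|X^\tau\|_{\gamma|\tau|}\le B\,A^{|\tau|}\,q_\gamma(\tau)\qquad\text{for all }\tau\in\mathcal{T}_{\mathcal{L}}.$$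
   Context: Trees. $\mathcal{L}$ is a finite set of labels. $\mathcal{T}_{\mathcal{L}}$ is the set of finite rooted trees (order of branches irrelevant) with vertices labeled by $\mathcal{L}$; $|\tau|$ is the number of vertices; $\bullet_a$ is the one-vertex tree; $[\tau_1\cdots\tau_k]_a$ is the tree obtained by attaching $\tau_1,\dots,\tau_k$ to a new root labeled $a$. $\mathcal{A}\mathcal{T}_{\mathcal{L}}$ is the unital commutative polynomial algebra over $\mathbb{R}$ generated by $\mathcal{T}_{\mathcal{L}}$; its monomials are forests (including the empty forest $1$), $\mathcal{F}_{\mathcal{L}}$ is the set of forests, with degree $|\tau_1\cdots\tau_k|=|\tau_1|+\cdots+|\tau_k|$, $|1|=0$. $\mathcal{A}_n\mathcal{T}_{\mathcal{L}}$ is the span of forests of degree $\le n$. $B_+^a$ is linear with $B_+^a(1)=\bullet_a$, $B_+^a(\tau_1\cdots\tau_k)=[\tau_1\cdots\tau_k]_a$. The coproduct $\Delta$ is the unital algebra homomorphism $\mathcal{A}\mathcal{T}_{\mathcal{L}}\to\mathcal{A}\mathcal{T}_{\mathcal{L}}\otimes\mathcal{A}\mathcal{T}_{\mathcal{L}}$ with $\Delta(B_+^a(\sigma))=1\otimes B_+^a(\sigma)+(B_+^a\otimes\mathrm{id})\Delta(\sigma)$ for forests $\sigma$; $\Delta'(\sigma)=\Delta(\sigma)-1\otimes\sigma-\sigma\otimes1$. Increments. Fix $T>0$. $\mathcal{C}_2$ is the set of functions $g:[0,T]^2\to\mathbb{R}$ with $g_{tt}=0$; $\mathcal{C}_2^+=\mathcal{C}_2\oplus\mathbb{R}e$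 with $e_{ts}=1$. $(\delta h)_{tus}=h_{ts}-h_{tu}-h_{us}$. $(gh)_{tus}=g_{tu}h_{us}$ and $(g\circ h)_{ts}=g_{ts}h_{ts}$. $\|f\|_\mu=\sup_{s\ne t}|f_{ts}|/|t-s|^\mu$. Homomorphisms. A homomorphism $X:\mathcal{A}\mathcal{T}_{\mathcal{L}}\to\mathcal{C}_2^+$ is linear with $X^1=e$, $X^{\sigma\rho}=X^\sigma\circ X^\rho$ and $X^\tau\in\mathcal{C}_2$ for every tree $\tau$. A partial homomorphism on $\mathcal{A}_n\mathcal{T}_{\mathcal{L}}$ is the same with multiplicativity required whenever the product has degree $\le n$. $X^{\sigma\otimes\rho}:=X^\sigma X^\rho$ (exterior product), extended linearly. The function $q_\gamma$. For $\gamma\in(0,1]$, $q_\gamma(\tau)=1$ if $|\tau|\le1/\gamma$; for a tree $\tau$ with $|\tau|>1/\gamma$, $$q_\gamma(\tau)=\frac{1}{2^{\gamma|\tau|}-2}\sum{}'q_\gamma(\tau^{(1)})q_\gamma(\tau^{(2)}),$$ where $\Delta'\tau=\sum'\tau^{(1)}\otimes\tau^{(2)}$ (sum over forest pairs, with multiplicity); and $q_\gamma(\tau_1\cdots\tau_k)=q_\gamma(\tau_1)\cdots q_\gamma(\tau_k)$ for trees $\tau_1,\dots,\tau_k$. Labels play no role in the value of $q_\gamma$. Branched rough path. A homomorphism $X:\mathcal{A}\mathcal{T}_{\mathcal{L}}\to\mathcal{C}_2^+$ is a branched rough path of roughness $\gamma$ if $\delta X^\sigma=X^{\Delta'(\sigma)}$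 for all $\sigma\in\mathcal{A}\mathcal{T}_{\mathcal{L}}$ and there are constants $B\in[0,1]$, $A\ge0$ with $\|X^\tau\|_{\gamma|\tau|}\le BA^{|\tau|}q_\gamma(\tau)$ for all nonempty forests $\tau$. *)

theory Defs
  imports "HOL-Analysis.Analysis" "HOL-Analysis.Finite_Function_Topology" "HOL-Library.Multiset"
begin

section \<open>Labelled rooted trees and the algebra of forests\<close>

datatype 'l tree = Node 'l "'l tree multiset"

type_synonym 'l forest = "'l tree multiset"

primrec nverts :: "'l tree \<Rightarrow> nat" where
  "nverts (Node a F) = Suc (\<Sum>n\<in>#image_mset nverts F. n)"

definition fdeg :: "'l forest \<Rightarrow> nat" where
  "fdeg F = (\<Sum>\<tau>\<in>#F. nverts \<tau>)"

text \<open>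
  The commutative polynomial algebra generated by the trees is the monoid algebra of the
  commutative monoid of forests, and its tensor square is the monoid algebra of pairs of forests:
  the pair \<open>(F, G)\<close> stands for the basis element \<open>F \<otimes> G\<close>.  The ring and vector space operations
  are those of the library on finitely supported functions.
\<close>

type_synonym 'l alg = "'l forest \<Rightarrow>\<^sub>0 real"
type_synonym 'l alg2 = "('l forest \<times> 'l forest) \<Rightarrow>\<^sub>0 real"

abbreviation basis_elt :: "'k \<Rightarrow> ('k \<Rightarrow>\<^sub>0 real)" where
  "basis_elt k \<equiv> Poly_Mapping.single k 1"

definition alg_upto :: "nat \<Rightarrow> 'l alg set" where
  "alg_upto n = span (basis_elt ` {F. fdeg F \<le> n})"

text \<open>Linear extension of a map given on basis elements.\<close>

definition lin_ext :: "('k \<Rightarrow> 'v::real_vector) \<Rightarrow> ('k \<Rightarrow>\<^sub>0 real) \<Rightarrow> 'v" where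
  "lin_ext f x = (\<Sum>k\<in>Poly_Mapping.keys x. Poly_Mapping.lookup x k *\<^sub>R f k)"

definition tensor :: "'l alg \<Rightarrow> 'l alg \<Rightarrow> 'l alg2" (infixr "\<otimes>\<^sub>a" 75) where
  "x \<otimes>\<^sub>a y = lin_ext (\<lambda>F. lin_ext (\<lambda>G. basis_elt (F, G)) y) x"

definition Bplus :: "'l \<Rightarrow> 'l alg \<Rightarrow> 'l alg" where
  "Bplus a = lin_ext (\<lambda>F. basis_elt {#Node a F#})"

text \<open>The map \<open>f \<otimes> id\<close> for linear \<open>f\<close>.\<close>

definition tensor_id :: "('l alg \<Rightarrow> 'l alg) \<Rightarrow> 'l alg2 \<Rightarrow> 'l alg2" where
  "tensor_id f = lin_ext (\<lambda>(F, G). f (basis_elt F) \<otimes>\<^sub>a basis_elt G)"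

text \<open>
  The coproduct is defined on trees by structural recursion, on forests multiplicatively, and then
  extended linearly.  The lemmas \<open>linear_coproduct\<close>, \<open>coproduct_one\<close>, \<open>coproduct_mult\<close> and
  \<open>coproduct_Bplus\<close> below are its defining properties.
\<close>

primrec coproduct_tree :: "'l tree \<Rightarrow> 'l alg2" where
  "coproduct_tree (Node a F) =
     1 \<otimes>\<^sub>a basis_elt {#Node a F#}
     + tensor_id (Bplus a) (\<Prod>x\<in>#image_mset coproduct_tree F. x)"

definition coproduct :: "'l alg \<Rightarrow> 'l alg2" where
  "coproduct = lin_ext (\<lambda>F. \<Prod>\<tau>\<in>#F. coproduct_tree \<tau>)"

definition red_coproduct :: "'l alg \<Rightarrow> 'l alg2" where
  "red_coproduct x = coproduct x - 1 \<otimes>\<^sub>a x - x \<otimes>\<^sub>a 1"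

subsection \<open>Basic properties of the coproduct\<close>

lemma lookup_scaleR_pm: "Poly_Mapping.lookup (c *\<^sub>R x) k = c * Poly_Mapping.lookup x k"
  for x :: "'k \<Rightarrow>\<^sub>0 real"
proof -
  have "{i. c * Poly_Mapping.lookup x i \<noteq> 0} \<subseteq> {i. Poly_Mapping.lookup x i \<noteq> 0}" by auto
  then have "finite {i. c * Poly_Mapping.lookup x i \<noteq> 0}"
    using finite_lookup finite_subset by blast
  then show ?thesis by (simp add: scaleR_poly_mapping_def)
qed

lemma lin_ext_superset:
  assumes "finite S" "Poly_Mapping.keys x \<subseteq> S"
  shows "lin_ext f x = (\<Sum>k\<in>S. Poly_Mapping.lookup x k *\<^sub>R f k)"
  unfolding lin_ext_def using assms
  by (intro sum.mono_neutral_left) (auto simp: in_keys_iff)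

lemma linear_lin_ext: "linear (lin_ext f)"
proof (rule linearI)
  fix x y :: "'a \<Rightarrow>\<^sub>0 real" and c :: real
  let ?S = "Poly_Mapping.keys x \<union> Poly_Mapping.keys y"
  show "lin_ext f (x + y) = lin_ext f x + lin_ext f y"
    using keys_add[of x y]
    by (simp add: lin_ext_superset[of ?S] lookup_add scaleR_add_left sum.distrib)
  have "Poly_Mapping.keys (c *\<^sub>R x) \<subseteq> Poly_Mapping.keys x"
    by (auto simp: in_keys_iff lookup_scaleR_pm)
  then show "lin_ext f (c *\<^sub>R x) = c *\<^sub>R lin_ext f x"
    by (simp add: lin_ext_superset[of "Poly_Mapping.keys x"] lookup_scaleR_pm
        flip: scaleR_right.sum)
       (simp add: scaleR_right.sum)
qed

lemma lin_ext_basis [simp]: "lin_ext f (basis_elt k) = f k"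
  by (simp add: lin_ext_def)

lemma pm_as_sum:
  "x = (\<Sum>k\<in>Poly_Mapping.keys x. Poly_Mapping.lookup x k *\<^sub>R basis_elt k)"
  by (rule poly_mapping_eqI)
     (auto simp: lookup_sum lookup_scaleR_pm lookup_single when_def in_keys_iff
       if_distrib[of "(*) _"] cong: if_cong)

lemma scaleR_pm_conv_mult: "c *\<^sub>R x = Poly_Mapping.single 0 c * x"
  for x :: "'k::comm_monoid_add \<Rightarrow>\<^sub>0 real"
proof -
  have "c *\<^sub>R x = Poly_Mapping.map ((*) c) x"
    by (rule poly_mapping_eqI) (simp add: lookup_scaleR_pm map.rep_eq when_def)
  then show ?thesis by (simp add: mult_map_scale_conv_mult)
qed

lemma lin_ext_mult:
  fixes f :: "'k::comm_monoid_add \<Rightarrow> ('m::comm_monoid_add \<Rightarrow>\<^sub>0 real)"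
  assumes f: "\<And>k l. f (k + l) = f k * f l"
  shows "lin_ext f (x * y) = lin_ext f x * lin_ext f y"
proof -
  note lin = linear_sum[OF linear_lin_ext] linear_scale[OF linear_lin_ext]
  have 1: "(a *\<^sub>R u) * (b *\<^sub>R v) = (a * b) *\<^sub>R (u * v)"
    for a b :: real and u v :: "'z::comm_monoid_add \<Rightarrow>\<^sub>0 real"
  proof -
    have "Poly_Mapping.single (0::'z) (a * b) = Poly_Mapping.single 0 a * Poly_Mapping.single 0 b"
      by (simp add: mult_single)
    then show ?thesis by (simp add: scaleR_pm_conv_mult ac_simps)
  qed
  have "x * y = (\<Sum>k\<in>Poly_Mapping.keys x. \<Sum>l\<in>Poly_Mapping.keys y.
      (Poly_Mapping.lookup x k * Poly_Mapping.lookup y l) *\<^sub>R basis_elt (k + l))"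
    by (subst pm_as_sum[of x], subst pm_as_sum[of y])
       (simp add: sum_product 1 mult_single)
  then show ?thesis
    by (simp add: lin f) (simp add: lin_ext_def sum_product 1)
qed

lemma tensor_basis [simp]: "basis_elt F \<otimes>\<^sub>a basis_elt G = basis_elt (F, G)"
  by (simp add: tensor_def)

lemma one_alg: "(1 :: 'l alg) = basis_elt {#}"
  using single_one[where 'a = "'l forest" and 'b = real] by simp

lemma one_alg2: "(1 :: 'l alg2) = basis_elt ({#}, {#})"
  using single_one[where 'a = "'l forest \<times> 'l forest" and 'b = real]
  by (simp add: zero_prod_def)

lemma linear_coproduct: "linear coproduct"
  unfolding coproduct_def by (rule linear_lin_ext)

lemma coproduct_basis: "coproduct (basis_elt F) = (\<Prod>\<tau>\<in>#F. coproduct_tree \<tau>)"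
  by (simp add: coproduct_def)

lemma coproduct_one: "coproduct 1 = 1"
  using coproduct_basis[of "{#}"] by (simp del: single_one flip: one_alg)

lemma coproduct_mult: "coproduct (x * y) = coproduct x * coproduct y"
  unfolding coproduct_def by (rule lin_ext_mult) simp

lemma Bplus_basis: "Bplus a (basis_elt F) = basis_elt {#Node a F#}"
  by (simp add: Bplus_def)

lemma coproduct_Bplus:
  "coproduct (Bplus a (basis_elt F)) =
     1 \<otimes>\<^sub>a Bplus a (basis_elt F) + tensor_id (Bplus a) (coproduct (basis_elt F))"
  by (simp add: Bplus_basis coproduct_basis)

text \<open>
  Both components of every term of the reduced coproduct of a tree have fewer vertices than the
  tree.  For this, split off the terms whose second component is the empty forest.
\<close>

lemma fdeg_simps [simp]:
  "fdeg {#} = 0" "fdeg (add_mset \<tau> F) = nverts \<tau> + fdeg F" "fdeg (F + G) = fdeg F + fdeg G"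
  by (simp_all add: fdeg_def)

lemma nverts_Node: "nverts (Node a F) = Suc (fdeg F)"
  by (simp add: fdeg_def)

declare nverts.simps [simp del] nverts_Node [simp]

lemma nverts_le_fdeg: "\<tau> \<in># F \<Longrightarrow> nverts \<tau> \<le> fdeg F"
  by (auto dest!: multi_member_split)

lemma nverts_pos: "0 < nverts \<tau>"
  by (cases \<tau>) simp

lemma fdeg_eq_0_iff: "fdeg F = 0 \<longleftrightarrow> F = {#}"
  by (cases F) (auto simp: nverts_pos)

definition coproduct_shape :: "'l forest \<Rightarrow> 'l alg2 \<Rightarrow> bool" where
  "coproduct_shape F x \<longleftrightarrow>
     (\<exists>r. x = basis_elt (F, {#}) + r \<and>
          (\<forall>(G, H)\<in>Poly_Mapping.keys r. fdeg G + fdeg H = fdeg F \<and> H \<noteq> {#}))"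

lemma coproduct_shape_mult:
  assumes "coproduct_shape F x" "coproduct_shape G y"
  shows "coproduct_shape (F + G) (x * y)"
proof -
  from assms obtain r s where
    x: "x = basis_elt (F, {#}) + r" and y: "y = basis_elt (G, {#}) + s" and
    r: "\<forall>(A, B)\<in>Poly_Mapping.keys r. fdeg A + fdeg B = fdeg F \<and> B \<noteq> {#}" and
    s: "\<forall>(A, B)\<in>Poly_Mapping.keys s. fdeg A + fdeg B = fdeg G \<and> B \<noteq> {#}"
    unfolding coproduct_shape_def by blast
  let ?t = "basis_elt (F, {#}) * s + (r * basis_elt (G, {#}) + r * s)"
  have "x * y = basis_elt (F + G, {#}) + ?t"
    by (simp add: x y algebra_simps mult_single)
  moreover have "\<forall>(A, B)\<in>Poly_Mapping.keys ?t. fdeg A + fdeg B = fdeg (F + G) \<and> B \<noteq> {#}"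
  proof -
    have "Poly_Mapping.keys ?t \<subseteq> Poly_Mapping.keys (basis_elt (F, {#}) * s) \<union>
        (Poly_Mapping.keys (r * basis_elt (G, {#})) \<union> Poly_Mapping.keys (r * s))"
      using keys_add by (meson Un_mono order_trans subset_refl)
    also have "\<dots> \<subseteq> {(A, B). fdeg A + fdeg B = fdeg (F + G) \<and> B \<noteq> {#}}"
      using keys_mult[of "basis_elt (F, {#})" s] keys_mult[of r "basis_elt (G, {#})"]
        keys_mult[of r s] r s
      by (fastforce simp: case_prod_beta)
    finally show ?thesis by auto
  qed
  ultimately show ?thesis unfolding coproduct_shape_def by blast
qed

lemma coproduct_shape_forest:
  assumes "\<And>\<tau>. \<tau> \<in># F \<Longrightarrow> coproduct_shape {#\<tau>#} (coproduct_tree \<tau>)"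
  shows "coproduct_shape F (\<Prod>\<tau>\<in>#F. coproduct_tree \<tau>)"
  using assms
proof (induction F)
  case empty
  have "coproduct_shape {#} (1 :: 'a alg2)"
    unfolding coproduct_shape_def by (rule exI[of _ 0]) (simp add: one_alg2 del: single_one)
  then show ?case by simp
next
  case (add \<tau> F)
  then show ?case
    using coproduct_shape_mult[of "{#\<tau>#}" "coproduct_tree \<tau>" F] by simp
qed

text \<open>The image of the remainder under \<open>Bplus a \<otimes> id\<close> has both components nonempty in every term.\<close>

lemma coproduct_tree_Node_split:
  assumes "coproduct_shape F (\<Prod>\<tau>\<in>#F. coproduct_tree \<tau>)"
  obtains r where
    "coproduct_tree (Node a F) = basis_elt ({#}, {#Node a F#}) + (basis_elt ({#Node a F#}, {#}) + r)"
    "\<forall>(G, H)\<in>Poly_Mapping.keys r. fdeg G + fdeg H = Suc (fdeg F) \<and> G \<noteq> {#} \<and> H \<noteq> {#}"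
proof -
  from assms obtain r where
    x: "(\<Prod>\<tau>\<in>#F. coproduct_tree \<tau>) = basis_elt (F, {#}) + r" and
    r: "\<forall>(G, H)\<in>Poly_Mapping.keys r. fdeg G + fdeg H = fdeg F \<and> H \<noteq> {#}"
    unfolding coproduct_shape_def by blast
  let ?r = "tensor_id (Bplus a) r"
  have "coproduct_tree (Node a F) =
      basis_elt ({#}, {#Node a F#}) + (basis_elt ({#Node a F#}, {#}) + ?r)"
    by (simp add: x tensor_id_def linear_add[OF linear_lin_ext] one_alg Bplus_basis
        del: single_one)
  moreover have "\<forall>(G, H)\<in>Poly_Mapping.keys ?r.
      fdeg G + fdeg H = Suc (fdeg F) \<and> G \<noteq> {#} \<and> H \<noteq> {#}"
  proof clarify
    fix G H assume "(G, H) \<in> Poly_Mapping.keys ?r"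
    then have "Poly_Mapping.lookup ?r (G, H) \<noteq> 0"
      by (simp add: in_keys_iff)
    moreover have "Poly_Mapping.lookup ?r (G, H) = (\<Sum>p\<in>Poly_Mapping.keys r.
        Poly_Mapping.lookup r p * Poly_Mapping.lookup (basis_elt ({#Node a (fst p)#}, snd p)) (G, H))"
      unfolding tensor_id_def lin_ext_def[of _ r] lookup_sum lookup_scaleR_pm
      by (simp add: Bplus_basis case_prod_beta)
    ultimately obtain p where p: "p \<in> Poly_Mapping.keys r" and
      "Poly_Mapping.lookup (basis_elt ({#Node a (fst p)#}, snd p)) (G, H) \<noteq> 0"
      by (metis (no_types, lifting) mult_zero_right sum.neutral)
    then have GH: "G = {#Node a (fst p)#}" "H = snd p"
      by (auto simp: lookup_single when_def split: if_splits)
    from p r have "fdeg (fst p) + fdeg (snd p) = fdeg F" "snd p \<noteq> {#}" by auto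
    with GH show "fdeg G + fdeg H = Suc (fdeg F) \<and> G \<noteq> {#} \<and> H \<noteq> {#}"
      by simp
  qed
  ultimately show ?thesis by (rule that)
qed

lemma coproduct_shape_tree: "coproduct_shape {#\<tau>#} (coproduct_tree \<tau>)"
proof (induction \<tau>)
  case (Node a F)
  obtain r where
    eq: "coproduct_tree (Node a F) =
      basis_elt ({#}, {#Node a F#}) + (basis_elt ({#Node a F#}, {#}) + r)" and
    r: "\<forall>(G, H)\<in>Poly_Mapping.keys r. fdeg G + fdeg H = Suc (fdeg F) \<and> G \<noteq> {#} \<and> H \<noteq> {#}"
    by (rule coproduct_tree_Node_split[OF coproduct_shape_forest[OF Node]]) simp_all
  let ?r = "basis_elt ({#}, {#Node a F#}) + r"
  have "coproduct_tree (Node a F) = basis_elt ({#Node a F#}, {#}) + ?r"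
    by (simp add: eq del: coproduct_tree.simps)
  moreover have "\<forall>(G, H)\<in>Poly_Mapping.keys ?r. fdeg G + fdeg H = fdeg {#Node a F#} \<and> H \<noteq> {#}"
    using keys_add[of "basis_elt ({#}, {#Node a F#})" r] r by fastforce
  ultimately show ?case unfolding coproduct_shape_def by blast
qed

lemma red_coproduct_tree_keys:
  assumes "(G, H) \<in> Poly_Mapping.keys (red_coproduct (basis_elt {#\<tau>#}))"
  shows "fdeg G + fdeg H = nverts \<tau>" "G \<noteq> {#}" "H \<noteq> {#}"
proof -
  obtain a F where \<tau>: "\<tau> = Node a F" by (cases \<tau>)
  obtain r where
    eq: "coproduct_tree (Node a F) =
      basis_elt ({#}, {#Node a F#}) + (basis_elt ({#Node a F#}, {#}) + r)" and
    r: "\<forall>(G, H)\<in>Poly_Mapping.keys r. fdeg G + fdeg H = Suc (fdeg F) \<and> G \<noteq> {#} \<and> H \<noteq> {#}"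
    by (rule coproduct_tree_Node_split[OF coproduct_shape_forest[OF coproduct_shape_tree]])
  have "red_coproduct (basis_elt {#\<tau>#}) = r"
    by (simp add: red_coproduct_def coproduct_basis \<tau> eq one_alg
        del: single_one coproduct_tree.simps)
  with assms r \<tau> show "fdeg G + fdeg H = nverts \<tau>" "G \<noteq> {#}" "H \<noteq> {#}" by auto
qed

lemma red_coproduct_tree_less:
  assumes "p \<in> Poly_Mapping.keys (red_coproduct (basis_elt {#\<tau>#}))"
    and "\<sigma> \<in># fst p \<or> \<sigma> \<in># snd p"
  shows "nverts \<sigma> < nverts \<tau>"
proof -
  have "fdeg (fst p) + fdeg (snd p) = nverts \<tau>" "fst p \<noteq> {#}" "snd p \<noteq> {#}"
    using red_coproduct_tree_keys[of "fst p" "snd p" \<tau>] assms(1) by simp_all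
  then have "fdeg (fst p) < nverts \<tau>" "fdeg (snd p) < nverts \<tau>"
    using fdeg_eq_0_iff[of "fst p"] fdeg_eq_0_iff[of "snd p"] by linarith+
  then show ?thesis
    using assms(2) nverts_le_fdeg[of \<sigma> "fst p"] nverts_le_fdeg[of \<sigma> "snd p"] by linarith
qed

section \<open>The function \<open>q\<^sub>\<gamma>\<close>\<close>

function q_tree :: "real \<Rightarrow> 'l tree \<Rightarrow> real" where
  "q_tree \<gamma> \<tau> =
    (if real (nverts \<tau>) \<le> 1 / \<gamma> then 1
     else 1 / (2 powr (\<gamma> * real (nverts \<tau>)) - 2) *
       (\<Sum>p\<in>Poly_Mapping.keys (red_coproduct (basis_elt {#\<tau>#})).
          Poly_Mapping.lookup (red_coproduct (basis_elt {#\<tau>#})) p *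
          ((\<Prod>\<sigma>\<in>#fst p. q_tree \<gamma> \<sigma>) * (\<Prod>\<sigma>\<in>#snd p. q_tree \<gamma> \<sigma>))))"
  by auto
termination
  by (relation "Wellfounded.measure (\<lambda>(\<gamma>, \<tau>). nverts \<tau>)") (auto intro: red_coproduct_tree_less)

declare q_tree.simps [simp del]

definition q_forest :: "real \<Rightarrow> 'l forest \<Rightarrow> real" where
  "q_forest \<gamma> F = (\<Prod>\<tau>\<in>#F. q_tree \<gamma> \<tau>)"

section \<open>Increments\<close>

text \<open>
  A function on \<open>[0,T] \<times> [0,T]\<close> is represented by its extension by zero to the plane, so that
  two functions on the square are equal iff their representatives are.
\<close>

type_synonym incr = "real \<Rightarrow> real \<Rightarrow> real"

definition C2 :: "real \<Rightarrow> incr set" where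
  "C2 T = {g. (\<forall>t s. \<not> (t \<in> {0..T} \<and> s \<in> {0..T}) \<longrightarrow> g t s = 0) \<and> (\<forall>t\<in>{0..T}. g t t = 0)}"

definition unit_incr :: "real \<Rightarrow> incr" where
  "unit_incr T = (\<lambda>t s. if t \<in> {0..T} \<and> s \<in> {0..T} then 1 else 0)"

definition C2_plus :: "real \<Rightarrow> incr set" where
  "C2_plus T = {\<lambda>t s. g t s + c * unit_incr T t s | g c. g \<in> C2 T}"

definition delta :: "incr \<Rightarrow> real \<Rightarrow> real \<Rightarrow> real \<Rightarrow> real" where
  "delta h t u s = h t s - h t u - h u s"

definition ext_prod :: "incr \<Rightarrow> incr \<Rightarrow> real \<Rightarrow> real \<Rightarrow> real \<Rightarrow> real" where
  "ext_prod g h t u s = g t u * h u s"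

definition hoelder_norm :: "real \<Rightarrow> real \<Rightarrow> incr \<Rightarrow> ereal" where
  "hoelder_norm T \<mu> f =
     (SUP (t, s)\<in>{(t, s). t \<in> {0..T} \<and> s \<in> {0..T} \<and> s \<noteq> t}. ereal (\<bar>f t s\<bar> / \<bar>t - s\<bar> powr \<mu>))"

section \<open>Homomorphisms and branched rough paths\<close>

text \<open>\<open>hom_on T V X\<close>: the restriction of \<open>X\<close> to the subspace \<open>V\<close> is linear into \<open>C2_plus T\<close>, unital, and
  multiplicative as far as products remain in \<open>V\<close>; values of \<open>X\<close> outside \<open>V\<close> are irrelevant.\<close>

definition hom_on :: "real \<Rightarrow> 'l alg set \<Rightarrow> ('l alg \<Rightarrow> incr) \<Rightarrow> bool" where
  "hom_on T V X \<longleftrightarrow>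
     (\<forall>x\<in>V. X x \<in> C2_plus T) \<and>
     (\<forall>x\<in>V. \<forall>y\<in>V. X (x + y) = (\<lambda>t s. X x t s + X y t s)) \<and>
     (\<forall>c. \<forall>x\<in>V. X (c *\<^sub>R x) = (\<lambda>t s. c * X x t s)) \<and>
     X 1 = unit_incr T \<and>
     (\<forall>x\<in>V. \<forall>y\<in>V. x * y \<in> V \<longrightarrow> X (x * y) = (\<lambda>t s. X x t s * X y t s)) \<and>
     (\<forall>\<tau>. basis_elt {#\<tau>#} \<in> V \<longrightarrow> X (basis_elt {#\<tau>#}) \<in> C2 T)"

abbreviation homomorphism :: "real \<Rightarrow> ('l alg \<Rightarrow> incr) \<Rightarrow> bool" where
  "homomorphism T X \<equiv> hom_on T UNIV X"

abbreviation partial_homomorphism :: "real \<Rightarrow> nat \<Rightarrow> ('l alg \<Rightarrow> incr) \<Rightarrow> bool" where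
  "partial_homomorphism T n X \<equiv> hom_on T (alg_upto n) X"

text \<open>\<open>X\<close> on the tensor square: \<open>F \<otimes> G\<close> is sent to the exterior product of \<open>X F\<close> and \<open>X G\<close>.\<close>

definition on_tensor :: "('l alg \<Rightarrow> incr) \<Rightarrow> 'l alg2 \<Rightarrow> real \<Rightarrow> real \<Rightarrow> real \<Rightarrow> real" where
  "on_tensor X z t u s =
     lin_ext (\<lambda>(F, G). ext_prod (X (basis_elt F)) (X (basis_elt G)) t u s) z"

definition chen_on :: "real \<Rightarrow> 'l alg set \<Rightarrow> ('l alg \<Rightarrow> incr) \<Rightarrow> bool" where
  "chen_on T V X \<longleftrightarrow>
     (\<forall>x\<in>V. \<forall>t\<in>{0..T}. \<forall>u\<in>{0..T}. \<forall>s\<in>{0..T}.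
        delta (X x) t u s = on_tensor X (red_coproduct x) t u s)"

definition branched_rough_path :: "real \<Rightarrow> real \<Rightarrow> ('l alg \<Rightarrow> incr) \<Rightarrow> bool" where
  "branched_rough_path T \<gamma> X \<longleftrightarrow>
     homomorphism T X \<and> chen_on T UNIV X \<and>
     (\<exists>B A. 0 \<le> B \<and> B \<le> 1 \<and> 0 \<le> A \<and>
        (\<forall>F. F \<noteq> {#} \<longrightarrow>
           hoelder_norm T (\<gamma> * real (fdeg F)) (X (basis_elt F))
             \<le> ereal (B * A ^ fdeg F * q_forest \<gamma> F)))"

end

theory Submission
  imports Defs
begin

text \<open>
  A homomorphism is determined by its values on trees, and Chen's relation need only be checked on
  trees, so \<open>X\<close> is extended tree by tree, by induction on the number of vertices.  Let \<open>\<tau>\<close> be a tree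
  with more than \<open>n\<close> vertices.  By coassociativity, \<open>h = X(\<Delta>' \<tau>)\<close> is a cocycle, hence \<open>h = \<delta> g\<^sub>0\<close> with
  \<open>g\<^sub>0 t s = - h t s 0\<close>; as \<open>\<gamma> |\<tau>| > 1\<close>, sewing yields a path \<open>f\<close> such that
  \<open>g t s = g\<^sub>0 t s - (f t - f s)\<close> is of order \<open>|t - s|\<close> to the power \<open>z = \<gamma> |\<tau>|\<close>.  Splitting
  intervals at the midpoint improves any such bound on \<open>g\<close> to the constant in which the
  factor \<open>1 / (2\<^sup>z - 2)\<close> is the one in the definition of \<open>q\<^sub>\<gamma> \<tau>\<close>, and applied to a difference of two
  solutions (for which \<open>h = 0\<close>) it gives uniqueness.  Products of at least two values on trees only
  improve the constant because \<open>B \<le> 1\<close>.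
\<close>

section \<open>Sewing\<close>

lemma sum_pairs_lessThan:
  fixes a :: "nat \<Rightarrow> 'a::comm_monoid_add"
  shows "(\<Sum>i<2 * m. a i) = (\<Sum>i<m. a (2 * i) + a (2 * i + 1))"
  by (induction m) (simp_all add: ac_simps)

text \<open>
  The path \<open>f\<close> is the limit over \<open>k\<close> of the sums of \<open>g\<close> over the cells of length \<open>T / 2^k\<close> between
  \<open>0\<close> and \<open>t\<close>, the last cell being cut off at \<open>t\<close>.  The grid does not depend on \<open>t\<close>, which makes the
  limit additive for free.
\<close>

lemma sewing_exists:
  fixes g :: "real \<Rightarrow> real \<Rightarrow> real"
  assumes T: "T > 0" and z: "z > 1" and C: "C \<ge> 0"
    and h: "\<And>t u s M. t \<in> {0..T} \<Longrightarrow> u \<in> {0..T} \<Longrightarrow> s \<in> {0..T} \<Longrightarrow>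
      \<bar>t - u\<bar> \<le> M \<Longrightarrow> \<bar>u - s\<bar> \<le> M \<Longrightarrow> \<bar>g t s - g t u - g u s\<bar> \<le> C * M powr z"
  obtains f K where "\<And>t s. t \<in> {0..T} \<Longrightarrow> s \<in> {0..T} \<Longrightarrow>
      \<bar>g t s - (f t - f s)\<bar> \<le> K * \<bar>t - s\<bar> powr z"
proof -

  \<comment> \<open>Dyadic grid and approximations\<close>
  define d where "d k = T / 2 ^ k" for k :: nat
  define N where "N k t = nat \<lfloor>t / d k\<rfloor>" for k t
  define x where "x k i = real i * d k" for k i
  define F where "F k t = (\<Sum>i<N k t. g (x k (i + 1)) (x k i)) + g t (x k (N k t))" for k t
  define P where "P k t = F (Suc k) t - F k t" for k t
  \<comment> \<open>The next level has twice as many cells, with the defect bound per cell divided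
    by \<open>2 powr z\<close>. The resulting ratio \<open>r\<close> is below 1 because
    \<open>z > 1\<close>.\<close>
  define r where "r = 2 powr (1 - z)"
  have d0: "d k > 0" for k using T by (simp add: d_def)
  have dS: "d (Suc k) = d k / 2" for k by (simp add: d_def)
  have x2: "x (Suc k) (2 * i) = x k i" for k i by (simp add: x_def dS)
  have xS: "x k (Suc i) = x k i + d k" for k i by (simp add: x_def algebra_simps)
  have xS2: "x (Suc k) (Suc (2 * i)) = x k i + d (Suc k)" for k i
    by (simp add: xS x2)
  have x0: "x k i \<ge> 0" for k i using d0[of k] by (simp add: x_def)
  have xmono: "x k i \<le> x k j" if "i \<le> j" for k i j
    using that d0[of k] by (simp add: x_def mult_right_mono)
  have N1: "x k (N k t) \<le> t" "t < x k (Suc (N k t))" if "t \<ge> 0" for k t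
  proof -
    have "0 \<le> t / d k" using that d0[of k] by simp
    then have "real (N k t) = of_int \<lfloor>t / d k\<rfloor>" unfolding N_def by simp
    then have "real (N k t) \<le> t / d k" "t / d k < real (N k t) + 1" by linarith+
    then show "x k (N k t) \<le> t" "t < x k (Suc (N k t))"
      using d0[of k] by (simp_all add: x_def field_simps)
  qed
  have Nuniq: "N k t = i" if "x k i \<le> t" "t < x k (Suc i)" for k t i
  proof -
    have "real i \<le> t / d k" "t / d k < real i + 1"
      using that d0[of k] by (simp_all add: x_def field_simps)
    then have "\<lfloor>t / d k\<rfloor> = int i" by linarith
    then show ?thesis by (simp add: N_def)
  qed
  have Nmono: "N k s \<le> N k t" if "s \<le> t" for k s t
    using that d0[of k] unfolding N_def
    by (intro nat_mono floor_mono divide_right_mono) auto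
  have Ndiff: "real (N k t) - real (N k s) \<le> (t - s) / d k + 1" if "0 \<le> s" "s \<le> t" for k s t
  proof -
    have "x k (N k t) - x k (N k s) \<le> t - s + d k"
      using N1[of t k] N1[of s k] that by (simp add: xS)
    then have "(real (N k t) - real (N k s)) * d k \<le> t - s + d k"
      by (simp add: x_def algebra_simps)
    then show ?thesis using d0[of k] by (simp add: field_simps)
  qed

  \<comment> \<open>Midpoint defects and one refinement of the grid\<close>
  define c where "c k i = g (x k (Suc i)) (x k i) - g (x k (Suc i)) (x (Suc k) (Suc (2 * i)))
      - g (x (Suc k) (Suc (2 * i))) (x k i)" for k i
  have cbd: "\<bar>c k i\<bar> \<le> C * d k powr z" if "x k (Suc i) \<le> T" for k i
    unfolding c_def using that x0[of k i] d0[of k] d0[of "Suc k"]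
    by (intro h) (auto simp: xS x2 dS)
  \<comment> \<open>Refining subtracts the midpoint defects of all full cells before
    \<open>t\<close>. The cell cut off at \<open>t\<close> contributes at most one more defect, and
    only if \<open>t\<close> has reached its midpoint.\<close>
  have Pform: "\<bar>P k t + (\<Sum>i<N k t. c k i)\<bar> \<le> C * d k powr z" if t: "t \<in> {0..T}" for k t
  proof -
    define m where "m = N k t"
    have m: "x k m \<le> t" "t < x k (Suc m)" using N1 t unfolding m_def by auto
    have F: "F k t = (\<Sum>i<m. g (x k (Suc i)) (x k i)) + g t (x k m)"
      by (simp add: F_def m_def)
    have pairs: "(\<Sum>i<2 * m. g (x (Suc k) (Suc i)) (x (Suc k) i)) =
        (\<Sum>i<m. g (x k (Suc i)) (x k i)) - (\<Sum>i<m. c k i)"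
    proof -
      have "x (Suc k) (Suc (Suc (2 * i))) = x k (Suc i)" for i
        using x2[of k "Suc i"] by simp
      then show ?thesis
        unfolding sum_pairs_lessThan sum_subtractf[symmetric]
        by (intro sum.cong) (simp_all add: c_def x2)
    qed
    show ?thesis
    proof (cases "t < x (Suc k) (Suc (2 * m))")
      case True
      then have "N (Suc k) t = 2 * m" using m by (intro Nuniq) (auto simp: x2)
      then have "P k t = - (\<Sum>i<m. c k i)"
        unfolding P_def F by (simp add: F_def pairs x2)
      then show ?thesis using C by (simp add: m_def)
    next
      case False
      have "x (Suc k) (Suc (Suc (2 * m))) = x k (Suc m)" using x2[of k "Suc m"] by simp
      then have "N (Suc k) t = Suc (2 * m)" using m False by (intro Nuniq) auto
      then have "P k t + (\<Sum>i<m. c k i) =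
          - (g t (x k m) - g t (x (Suc k) (Suc (2 * m))) - g (x (Suc k) (Suc (2 * m))) (x k m))"
        unfolding P_def F by (simp add: F_def pairs x2)
      also have "\<bar>\<dots>\<bar> \<le> C * d k powr z"
        unfolding abs_minus_cancel using t x0[of k m] m d0[of "Suc k"] False
        by (intro h) (auto simp: xS x2 dS)
      finally show ?thesis by (simp add: m_def)
    qed
  qed
  \<comment> \<open>The defects of full cells before \<open>s\<close> cancel. At most
    \<open>(t - s) / d k + 1\<close> full cells remain, and the two cut-off cells account for the
    other 2.\<close>
  have Pdiff0: "\<bar>P k t - P k s\<bar> \<le> ((t - s) / d k + 3) * (C * d k powr z)"
    if s: "0 \<le> s" and st: "s \<le> t" and t: "t \<le> T" for k t s
  proof -
    let ?D = "C * d k powr z"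
    have D: "?D \<ge> 0" using C by simp
    have split: "(\<Sum>i<N k t. c k i) = (\<Sum>i<N k s. c k i) + (\<Sum>i\<in>{N k s..<N k t}. c k i)"
      using Nmono[OF st, of k] by (simp add: sum.atLeastLessThan_concat lessThan_atLeast0)
    have "\<bar>\<Sum>i\<in>{N k s..<N k t}. c k i\<bar> \<le> (\<Sum>i\<in>{N k s..<N k t}. ?D)"
    proof (rule order_trans[OF sum_abs], rule sum_mono)
      fix i assume "i \<in> {N k s..<N k t}"
      then have "x k (Suc i) \<le> x k (N k t)" by (intro xmono) auto
      also have "\<dots> \<le> T" using N1(1)[of t k] s st t by linarith
      finally show "\<bar>c k i\<bar> \<le> ?D" by (rule cbd)
    qed
    also have "\<dots> = (real (N k t) - real (N k s)) * ?D"
      using Nmono[OF st, of k] by (simp add: of_nat_diff)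
    also have "\<dots> \<le> ((t - s) / d k + 1) * ?D"
      using Ndiff[OF s st] D by (rule mult_right_mono)
    finally have "\<bar>\<Sum>i\<in>{N k s..<N k t}. c k i\<bar> \<le> ((t - s) / d k + 1) * ?D" .
    moreover have "\<bar>P k t + (\<Sum>i<N k t. c k i)\<bar> \<le> ?D" "\<bar>P k s + (\<Sum>i<N k s. c k i)\<bar> \<le> ?D"
      using Pform s st t by auto
    ultimately show ?thesis unfolding split by (simp add: algebra_simps)
  qed

  \<comment> \<open>Geometric decay over the levels\<close>
  have dpow: "d (k + j) powr z * 2 ^ j = d k powr z * r ^ j" for k j
  proof -
    have "d (k + j) = d k / 2 powr real j"
      by (simp add: d_def power_add powr_realpow)
    then have "d (k + j) powr z = d k powr z / (2 powr real j) powr z"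
      using d0[of k] by (simp add: powr_divide)
    moreover have "r ^ j = 2 powr real j / (2 powr real j) powr z"
      by (simp add: r_def powr_powr powr_diff[symmetric] algebra_simps flip: powr_realpow)
    ultimately show ?thesis by (simp add: powr_realpow)
  qed
  have Pdiff: "\<bar>P (k + j) t - P (k + j) s\<bar> \<le> 4 * C * d k powr z * r ^ j"
    if s: "0 \<le> s" and st: "s \<le> t" and t: "t \<le> T" and ts: "t - s \<le> d k" for k j t s
  proof -
    have "(t - s) / d (k + j) \<le> d k / d (k + j)"
      using ts d0[of "k+j"] by (simp add: divide_right_mono)
    also have "\<dots> = 2 ^ j" using T by (simp add: d_def power_add)
    \<comment> \<open>The 3 is absorbed into the factor 4 because
      \<open>2 ^ j \<ge> 1\<close>.\<close>
    finally have "(t - s) / d (k + j) + 3 \<le> 4 * 2 ^ j"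
      using one_le_power[of "2::real" j] by linarith
    then have "((t - s) / d (k + j) + 3) * (C * d (k + j) powr z) \<le> (4 * 2 ^ j) * (C * d (k + j) powr z)"
      using C by (intro mult_right_mono) auto
    also have "\<dots> = 4 * C * (d (k + j) powr z * 2 ^ j)" by simp
    finally show ?thesis using Pdiff0[OF s st t, of "k + j"] by (simp only: dpow mult.assoc)
  qed
  have r: "0 < r" "r < 1" using z by (simp_all add: r_def powr_less_one)
  have P0: "P k 0 = 0" for k by (simp add: P_def F_def N_def x_def)
  \<comment> \<open>As \<open>P k 0 = 0\<close> and \<open>d 0 = T\<close>, the bound
    \<open>Pdiff\<close> with \<open>s = 0\<close> from level 0 onwards gives a geometric
    majorant.\<close>
  have sumP: "summable (\<lambda>k. P k t)" if "t \<in> {0..T}" for t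
  proof (rule summable_comparison_test'[where N = 0])
    show "summable (\<lambda>j. 4 * C * d 0 powr z * r ^ j)"
      using r by (intro summable_mult summable_geometric) auto
    show "norm (P j t) \<le> 4 * C * d 0 powr z * r ^ j" for j
      using Pdiff[of 0 t 0 j] that P0[of j] by (simp add: d_def)
  qed
  define f where "f t = F 0 t + suminf (\<lambda>k. P k t)" for t
  \<comment> \<open>The first summand is the geometric tail of the refinements, the second the error
    at the level matching \<open>t - s\<close>. The factor \<open>2 powr z\<close> pays for
    replacing \<open>d k\<close> by \<open>2 * (t - s)\<close>.\<close>
  define K where "K = (4 * C / (1 - r) + 2 * C) * 2 powr z"
  have K0: "K \<ge> 0" using r C by (simp add: K_def)

  \<comment> \<open>Estimate at the scale of the interval\<close>
  have main: "\<bar>g t s - (f t - f s)\<bar> \<le> K * \<bar>t - s\<bar> powr z"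
    if s: "0 \<le> s" and st: "s < t" and t: "t \<le> T" for t s
  proof -
    \<comment> \<open>The first level with mesh below \<open>t - s\<close> is not level 0, since
      \<open>d 0 = T\<close>; \<open>k\<close> is its predecessor.\<close>
    obtain k where k: "t - s \<le> d k" "d (Suc k) < t - s"
    proof -
      have "(\<lambda>k. T * (1 / 2) ^ k) \<longlonglongrightarrow> T * 0"
        by (intro tendsto_mult tendsto_const LIMSEQ_power_zero) simp
      then have "d \<longlonglongrightarrow> 0" by (simp add: d_def[abs_def] power_one_over field_simps)
      then have "eventually (\<lambda>k. d k < t - s) sequentially"
        using st by (intro order_tendstoD) auto
      then have ex: "\<exists>k. d k < t - s" by (auto simp: eventually_sequentially)
      let ?l = "LEAST k. d k < t - s"
      have l: "d ?l < t - s" using ex by (rule LeastI_ex)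
      moreover have "d 0 \<ge> t - s" using s t by (simp add: d_def)
      ultimately obtain k where k: "?l = Suc k" by (cases ?l) (auto simp: not_less)
      have "\<not> d k < t - s" using not_less_Least[of k "\<lambda>k. d k < t - s"] k by simp
      then show ?thesis using that[of k] l k by simp
    qed
    let ?D = "C * d k powr z"
    have fF: "f t' = F k t' + suminf (\<lambda>j. P (k + j) t')" if "t' \<in> {0..T}" for t'
    proof -
      have "F k t' = F 0 t' + (\<Sum>i<k. P i t')" by (induction k) (simp_all add: P_def)
      then show ?thesis
        using suminf_split_initial_segment[OF sumP[OF that], of k]
        by (simp add: f_def add.commute[of k])
    qed
    have sumk: "summable (\<lambda>j. P (k + j) t')" if "t' \<in> {0..T}" for t'
      using sumP[OF that] summable_iff_shift[of "\<lambda>j. P j t'" k] by (simp add: add.commute)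
    have "\<bar>suminf (\<lambda>j. P (k + j) t - P (k + j) s)\<bar> \<le> suminf (\<lambda>j. 4 * C * d k powr z * r ^ j)"
      using Pdiff[OF s _ t k(1)] st r
      by (subst real_norm_def[symmetric], intro norm_suminf_le summable_mult summable_geometric) auto
    also have "\<dots> = 4 * C / (1 - r) * d k powr z"
      using r by (simp add: suminf_mult suminf_geometric)
    finally have 1: "\<bar>suminf (\<lambda>j. P (k + j) t - P (k + j) s)\<bar> \<le> 4 * C / (1 - r) * d k powr z" .
    \<comment> \<open>As \<open>t - s \<le> d k\<close>, the point \<open>t\<close> lies in the cell
      of \<open>s\<close> or in the next one. The error is then a combination of one or two
      defects.\<close>
    have 2: "\<bar>g t s - (F k t - F k s)\<bar> \<le> 2 * ?D"
    proof -
      define p where "p = x k (N k s)"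
      have p: "0 \<le> p" "p \<le> s" "s < p + d k" using N1[OF s, of k] x0 unfolding p_def xS by auto
      have b1: "\<bar>g t p - g t s - g s p\<bar> \<le> ?D"
        using s st t k p by (intro h) auto
      show ?thesis
      proof (cases "t < p + d k")
        case True
        then have "N k t = N k s" using p st by (intro Nuniq) (auto simp: p_def xS)
        then have "g t s - (F k t - F k s) = - (g t p - g t s - g s p)"
          by (simp add: F_def p_def)
        moreover have "?D \<ge> 0" using C by simp
        ultimately show ?thesis using b1 by linarith
      next
        case False
        then have "N k t = Suc (N k s)" using p st k by (intro Nuniq) (auto simp: p_def xS)
        then have "g t s - (F k t - F k s) =
            (g t p - g t (p + d k) - g (p + d k) p) - (g t p - g t s - g s p)"
          by (simp add: F_def p_def xS)
        moreover have "\<bar>g t p - g t (p + d k) - g (p + d k) p\<bar> \<le> ?D"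
          using s st t k p False d0[of k] by (intro h) auto
        ultimately show ?thesis using b1 by linarith
      qed
    qed
    have "f t - f s = (F k t - F k s) + suminf (\<lambda>j. P (k + j) t - P (k + j) s)"
      using fF sumk s st t by (simp add: suminf_diff)
    with 1 2 have "\<bar>g t s - (f t - f s)\<bar> \<le> 4 * C / (1 - r) * d k powr z + 2 * ?D"
      by linarith
    also have "\<dots> = (4 * C / (1 - r) + 2 * C) * d k powr z" by (simp add: algebra_simps)
    also have "\<dots> \<le> (4 * C / (1 - r) + 2 * C) * (2 * (t - s)) powr z"
      using k dS[of k] C r z d0[of k] by (intro mult_left_mono powr_mono2) auto
    also have "\<dots> = K * \<bar>t - s\<bar> powr z"
      using st powr_mult[of 2 "t - s" z] by (simp add: K_def del: right_diff_distrib_numeral)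
    finally show ?thesis .
  qed
  \<comment> \<open>With all three times equal and \<open>M = 0\<close>, the hypothesis reads
    \<open>\<bar>g t t\<bar> \<le> 0\<close>.\<close>
  have diag: "g t t = 0" if "t \<in> {0..T}" for t
    using h[OF that that that, of 0] by simp
  show ?thesis
  proof (rule that[of f "K + C"])
    fix t s assume t: "t \<in> {0..T}" and s: "s \<in> {0..T}"
    have CP: "0 \<le> C * \<bar>t - s\<bar> powr z" using C by simp
    consider "t = s" | "s < t" | "t < s" by linarith
    then show "\<bar>g t s - (f t - f s)\<bar> \<le> (K + C) * \<bar>t - s\<bar> powr z"
    proof cases
      case 1
      then show ?thesis using diag[OF s] by simp
    next
      case 2
      then show ?thesis using main[of s t] s t CP by (simp add: algebra_simps)
    next
      \<comment> \<open>Since \<open>g\<close> vanishes on the diagonal,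
        \<open>g t s + g s t\<close> is a defect up to sign; reversing the times therefore costs the
        extra \<open>C\<close>.\<close>
      case 3
      then have "\<bar>g s t - (f s - f t)\<bar> \<le> K * \<bar>t - s\<bar> powr z"
        using main[of t s] s t by (simp add: abs_minus_commute)
      moreover have "\<bar>g t t - g t s - g s t\<bar> \<le> C * \<bar>t - s\<bar> powr z"
        using s t by (intro h) auto
      ultimately show ?thesis using diag[OF t] by (simp add: algebra_simps)
    qed
  qed
qed

text \<open>Splitting at the midpoint turns a bound with constant \<open>a\<close> into one with
  \<open>(2 * a + C) / 2 powr z\<close>. This is a contraction because \<open>z > 1\<close>, with
  fixed point \<open>C / (2 powr z - 2)\<close>. The crude \<open>K\<close> starts the iteration,
  and its excess over the fixed point tends to 0.\<close>

lemma bound_by_midpoint_defect: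
  fixes g :: "real \<Rightarrow> real \<Rightarrow> real"
  assumes z: "z > 1" and C: "C \<ge> 0"
    and fin: "\<And>t s. t \<in> {0..T} \<Longrightarrow> s \<in> {0..T} \<Longrightarrow> \<bar>g t s\<bar> \<le> K * \<bar>t - s\<bar> powr z"
    and mid: "\<And>t s. t \<in> {0..T} \<Longrightarrow> s \<in> {0..T} \<Longrightarrow>
      \<bar>g t s - g t ((t + s) / 2) - g ((t + s) / 2) s\<bar> \<le> C * (\<bar>t - s\<bar> / 2) powr z"
    and t: "t \<in> {0..T}" and s: "s \<in> {0..T}"
  shows "\<bar>g t s\<bar> \<le> C / (2 powr z - 2) * \<bar>t - s\<bar> powr z"
proof -
  define q where "q = 2 powr z"
  have q: "q > 2" using powr_less_mono[of 1 z 2] z by (simp add: q_def)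
  define c where "c = C / (q - 2)"
  define L where "L = max (K - c) 0"
  have step: "\<bar>g t s\<bar> \<le> (c + L * (2 / q) ^ k) * \<bar>t - s\<bar> powr z"
    if "t \<in> {0..T}" "s \<in> {0..T}" for k t s
    using that
  proof (induction k arbitrary: t s)
    case 0
    have "K * \<bar>t - s\<bar> powr z \<le> (c + L) * \<bar>t - s\<bar> powr z"
      by (intro mult_right_mono) (auto simp: L_def)
    then show ?case using fin[OF 0] by simp
  next
    case (Suc k)
    let ?m = "(t + s) / 2" and ?a = "c + L * (2 / q) ^ k"
    have m: "?m \<in> {0..T}" using Suc.prems by auto
    have half: "(\<bar>t - s\<bar> / 2) powr z = \<bar>t - s\<bar> powr z / q"
      by (simp add: powr_divide q_def)
    have e: "\<bar>t - ?m\<bar> = \<bar>t - s\<bar> / 2" "\<bar>?m - s\<bar> = \<bar>t - s\<bar> / 2"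
      by (auto simp: abs_if field_simps)
    have "\<bar>g t ?m\<bar> \<le> ?a * (\<bar>t - s\<bar> powr z / q)" "\<bar>g ?m s\<bar> \<le> ?a * (\<bar>t - s\<bar> powr z / q)"
      using Suc.IH[OF Suc.prems(1) m] Suc.IH[OF m Suc.prems(2)] unfolding e half by auto
    moreover have "\<bar>g t s - g t ?m - g ?m s\<bar> \<le> C * (\<bar>t - s\<bar> powr z / q)"
      using mid[OF Suc.prems] unfolding half .
    ultimately have "\<bar>g t s\<bar> \<le> 2 * (?a * (\<bar>t - s\<bar> powr z / q)) + C * (\<bar>t - s\<bar> powr z / q)"
      by linarith
    also have "\<dots> = ((2 * c + C) / q + L * (2 / q) ^ Suc k) * \<bar>t - s\<bar> powr z"
      by (simp add: field_simps add_divide_distrib)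
    also have "(2 * c + C) / q = c" using q by (simp add: c_def field_simps)
    finally show ?case .
  qed
  have "(\<lambda>k. (c + L * (2 / q) ^ k) * \<bar>t - s\<bar> powr z) \<longlonglongrightarrow> (c + L * 0) * \<bar>t - s\<bar> powr z"
    using q by (intro tendsto_intros LIMSEQ_power_zero) auto
  then have "\<bar>g t s\<bar> \<le> (c + L * 0) * \<bar>t - s\<bar> powr z"
    by (rule tendsto_lowerbound) (use step[OF t s] in auto)
  then show ?thesis by (simp add: c_def q_def)
qed

section \<open>Linear extensions\<close>

lemma linear_eq_on_basis_elt:
  assumes "linear f" "linear g" "\<And>k. f (basis_elt k) = g (basis_elt k)"
  shows "f = g"
proof
  fix x
  show "f x = g x"
    by (subst (1 2) pm_as_sum[of x])
       (simp add: linear_sum[OF assms(1)] linear_scale[OF assms(1)]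
         linear_sum[OF assms(2)] linear_scale[OF assms(2)] assms(3))
qed

lemmas lin_ext_add = linear_add[OF linear_lin_ext]
  and lin_ext_diff = linear_diff[OF linear_lin_ext]

lemma linear_comp_lin_ext:
  assumes "linear f"
  shows "f (lin_ext g x) = lin_ext (\<lambda>k. f (g k)) x"
  unfolding lin_ext_def by (simp add: linear_sum[OF assms] linear_scale[OF assms])

lemma lin_ext_cong:
  assumes "\<And>k. k \<in> Poly_Mapping.keys x \<Longrightarrow> f k = g k"
  shows "lin_ext f x = lin_ext g x"
  unfolding lin_ext_def using assms by simp

text \<open>\<open>lin_ext_mult\<close> concerns values in an algebra of finitely supported
  functions; the reals are embedded there as multiples of the unit.\<close>

lemma lin_ext_mult_real:
  fixes f :: "'k::comm_monoid_add \<Rightarrow> real"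
  assumes f: "\<And>k l. f (k + l) = f k * f l"
  shows "lin_ext f (x * y) = lin_ext f x * lin_ext f y"
proof -
  let ?c = "\<lambda>a. Poly_Mapping.single (0::nat) a :: nat \<Rightarrow>\<^sub>0 real"
  have lin: "linear ?c"
    by (rule linearI) (simp_all add: single_add scaleR_pm_conv_mult mult_single)
  have "?c (lin_ext f (x * y)) = ?c (lin_ext f x) * ?c (lin_ext f y)"
    unfolding linear_comp_lin_ext[OF lin]
    by (rule lin_ext_mult) (simp add: f mult_single)
  also have "\<dots> = ?c (lin_ext f x * lin_ext f y)" by (simp add: mult_single)
  finally show ?thesis by (metis lookup_single_eq)
qed

lemma linear_times_pm: "linear ((*) x)"
  for x :: "'k::comm_monoid_add \<Rightarrow>\<^sub>0 real"
  by (rule linearI) (simp_all add: distrib_left scaleR_pm_conv_mult ac_simps)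

section \<open>Coassociativity\<close>

type_synonym 'l alg3 = "('l forest \<times> 'l forest \<times> 'l forest) \<Rightarrow>\<^sub>0 real"

definition emb_left :: "'l alg2 \<Rightarrow> 'l alg3" where
  "emb_left = lin_ext (\<lambda>(F, G). basis_elt (F, G, {#}))"

definition emb_right :: "'l alg2 \<Rightarrow> 'l alg3" where
  "emb_right = lin_ext (\<lambda>(F, G). basis_elt ({#}, F, G))"

text \<open>With \<open>emb_left x\<close> as x tensor 1 and \<open>emb_right x\<close> as 1 tensor
  x, this is \<Delta> tensor id, and \<open>coproduct_right\<close> is id tensor \<Delta>. Written
  with products of embedded factors, they inherit multiplicativity from
  \<open>coproduct\<close>.\<close>

definition coproduct_left :: "'l alg2 \<Rightarrow> 'l alg3" where
  "coproduct_left = lin_ext (\<lambda>(F, H). emb_left (coproduct (basis_elt F)) * basis_elt ({#}, {#}, H))"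

definition coproduct_right :: "'l alg2 \<Rightarrow> 'l alg3" where
  "coproduct_right = lin_ext (\<lambda>(F, H). basis_elt (F, {#}, {#}) * emb_right (coproduct (basis_elt H)))"

definition graft3 :: "'l \<Rightarrow> 'l alg3 \<Rightarrow> 'l alg3" where
  "graft3 a = lin_ext (\<lambda>(F, G, H). basis_elt ({#Node a F#}, G, H))"

lemma linear_coproduct_maps:
  "linear emb_left" "linear emb_right" "linear coproduct_left" "linear coproduct_right"
  "linear (graft3 a)" "linear (tensor_id f)"
  by (simp_all add: emb_left_def emb_right_def coproduct_left_def coproduct_right_def graft3_def
      tensor_id_def linear_lin_ext)

lemma coproduct_basis_add:
  "coproduct (basis_elt (F + G)) = coproduct (basis_elt F) * coproduct (basis_elt G)"
  by (simp add: coproduct_basis)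

lemma coproduct_1: "coproduct 1 = basis_elt ({#}, {#})"
  using coproduct_one by (simp add: one_alg2 del: single_one)

lemma emb_mult: "emb_left (x * y) = emb_left x * emb_left y" "emb_right (x * y) = emb_right x * emb_right y"
  unfolding emb_left_def emb_right_def by (rule lin_ext_mult; auto simp: mult_single)+

lemma coproduct_left_mult: "coproduct_left (x * y) = coproduct_left x * coproduct_left y"
  unfolding coproduct_left_def
proof (rule lin_ext_mult, clarify)
  fix F H F' H' :: "'a forest"
  have "basis_elt ({#}, {#}, H + H') = basis_elt ({#}, {#}, H) * (basis_elt ({#}, {#}, H') :: 'a alg3)"
    by (simp add: mult_single)
  then show "(case (F, H) + (F', H') of
      (F, H) \<Rightarrow> emb_left (coproduct (basis_elt F)) * basis_elt ({#}, {#}, H)) =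
    emb_left (coproduct (basis_elt F)) * basis_elt ({#}, {#}, H) *
    (emb_left (coproduct (basis_elt F')) * basis_elt ({#}, {#}, H'))"
    by (simp only: coproduct_basis_add emb_mult add_Pair prod.case ac_simps)
qed

lemma coproduct_right_mult: "coproduct_right (x * y) = coproduct_right x * coproduct_right y"
  unfolding coproduct_right_def
proof (rule lin_ext_mult, clarify)
  fix F H F' H' :: "'a forest"
  have "basis_elt (F + F', {#}, {#}) = basis_elt (F, {#}, {#}) * (basis_elt (F', {#}, {#}) :: 'a alg3)"
    by (simp add: mult_single)
  then show "(case (F, H) + (F', H') of
      (F, H) \<Rightarrow> basis_elt (F, {#}, {#}) * emb_right (coproduct (basis_elt H))) =
    basis_elt (F, {#}, {#}) * emb_right (coproduct (basis_elt H)) *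
    (basis_elt (F', {#}, {#}) * emb_right (coproduct (basis_elt H')))"
    by (simp only: coproduct_basis_add emb_mult add_Pair prod.case ac_simps)
qed

lemma tensor_id_Bplus_basis:
  "tensor_id (Bplus a) (basis_elt (F, G)) = basis_elt ({#Node a F#}, G)"
  by (simp add: tensor_id_def Bplus_basis)

lemma coproduct_Node:
  "coproduct (basis_elt {#Node a F#}) =
     basis_elt ({#}, {#Node a F#}) + tensor_id (Bplus a) (coproduct (basis_elt F))"
  using coproduct_Bplus[of a F] by (simp add: Bplus_basis one_alg del: single_one)

lemma emb_left_tensor_id: "emb_left (tensor_id (Bplus a) x) = graft3 a (emb_left x)"
proof -
  have "emb_left \<circ> tensor_id (Bplus a) = graft3 a \<circ> emb_left"
    by (intro linear_eq_on_basis_elt linear_compose linear_coproduct_maps)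
      (auto simp: tensor_id_Bplus_basis emb_left_def graft3_def)
  then show ?thesis by (auto simp: fun_eq_iff)
qed

lemma graft3_mult_basis: "graft3 a x * basis_elt ({#}, G, H) = graft3 a (x * basis_elt ({#}, G, H))"
proof -
  have "(\<lambda>x. basis_elt ({#}, G, H) * x) \<circ> graft3 a = graft3 a \<circ> (\<lambda>x. basis_elt ({#}, G, H) * x)"
    by (intro linear_eq_on_basis_elt linear_compose linear_coproduct_maps linear_times_pm)
      (auto simp: graft3_def mult_single)
  then show ?thesis by (auto simp: fun_eq_iff mult.commute)
qed

text \<open>The recursion for \<Delta> is applied in the first factor: its term with empty first
  component gives the \<open>emb_right\<close> summand, and the rest is grafted.\<close>

lemma coproduct_left_tensor_id:
  "coproduct_left (tensor_id (Bplus a) z) = emb_right (tensor_id (Bplus a) z) + graft3 a (coproduct_left z)"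
proof -
  have "coproduct_left \<circ> tensor_id (Bplus a) =
      (\<lambda>z. (emb_right \<circ> tensor_id (Bplus a)) z + (graft3 a \<circ> coproduct_left) z)"
  proof (intro linear_eq_on_basis_elt linear_compose linear_compose_add linear_coproduct_maps)
    fix k :: "'a forest \<times> 'a forest"
    obtain F H where k: "k = (F, H)" by (cases k)
    have "emb_left (basis_elt ({#}, {#Node a F#})) * basis_elt ({#}, {#}, H) =
        emb_right (basis_elt ({#Node a F#}, H))"
      by (simp add: emb_left_def emb_right_def mult_single)
    then show "(coproduct_left \<circ> tensor_id (Bplus a)) (basis_elt k) =
        (emb_right \<circ> tensor_id (Bplus a)) (basis_elt k) + (graft3 a \<circ> coproduct_left) (basis_elt k)"
      by (simp add: k coproduct_left_def tensor_id_Bplus_basis coproduct_Node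
          linear_add[OF linear_coproduct_maps(1)] emb_left_tensor_id graft3_mult_basis distrib_right)
  qed
  then show ?thesis by (auto simp: fun_eq_iff)
qed

lemma graft3_basis_mult:
  "basis_elt ({#Node a F#}, {#}, {#}) * emb_right x = graft3 a (basis_elt (F, {#}, {#}) * emb_right x)"
proof -
  have "(\<lambda>x. basis_elt ({#Node a F#}, {#}, {#}) * x) \<circ> emb_right =
      graft3 a \<circ> ((\<lambda>x. basis_elt (F, {#}, {#}) * x) \<circ> emb_right)"
    by (intro linear_eq_on_basis_elt linear_compose linear_coproduct_maps linear_times_pm)
      (auto simp: graft3_def emb_right_def mult_single)
  then show ?thesis by (auto simp: fun_eq_iff)
qed

lemma coproduct_right_tensor_id:
  "coproduct_right (tensor_id (Bplus a) z) = graft3 a (coproduct_right z)"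
proof -
  have "coproduct_right \<circ> tensor_id (Bplus a) = graft3 a \<circ> coproduct_right"
    by (intro linear_eq_on_basis_elt linear_compose linear_coproduct_maps)
      (auto simp: coproduct_right_def tensor_id_Bplus_basis graft3_basis_mult)
  then show ?thesis by (auto simp: fun_eq_iff)
qed

text \<open>Both iterated coproducts are multiplicative. Kept apart from the tree case so that the
  tree induction can use it for the children of the root.\<close>

lemma coassociative_forest:
  assumes "\<And>\<tau>. \<tau> \<in># F \<Longrightarrow>
      coproduct_left (coproduct (basis_elt {#\<tau>#})) = coproduct_right (coproduct (basis_elt {#\<tau>#}))"
  shows "coproduct_left (coproduct (basis_elt F)) = coproduct_right (coproduct (basis_elt F))"
  using assms
proof (induction F)
  case empty
  show ?case
    by (simp add: coproduct_1 coproduct_left_def coproduct_right_def emb_left_def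
        emb_right_def mult_single)
next
  case (add \<tau> F)
  have "coproduct (basis_elt (add_mset \<tau> F)) = coproduct (basis_elt {#\<tau>#}) * coproduct (basis_elt F)"
    using coproduct_basis_add[of "{#\<tau>#}" F] by simp
  with add show ?case by (simp add: coproduct_left_mult coproduct_right_mult)
qed

text \<open>Both iterated coproducts of \<tau> split into \<open>emb_right\<close> of \<Delta>\<tau>
  and a grafted term; the grafted terms agree by induction.\<close>

lemma coassociative_tree:
  "coproduct_left (coproduct (basis_elt {#\<tau>#})) = coproduct_right (coproduct (basis_elt {#\<tau>#}))"
proof (induction \<tau>)
  case (Node a F)
  have IH: "coproduct_left (coproduct (basis_elt F)) = coproduct_right (coproduct (basis_elt F))"
    by (rule coassociative_forest) (rule Node)
  have "coproduct_left (basis_elt ({#}, {#Node a F#})) = emb_right (basis_elt ({#}, {#Node a F#}))"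
    by (simp add: coproduct_left_def coproduct_1 emb_left_def emb_right_def mult_single)
  moreover have "coproduct_right (basis_elt ({#}, {#Node a F#})) =
      emb_right (coproduct (basis_elt {#Node a F#}))"
  proof -
    have "basis_elt ({#}, {#}, {#}) = (1 :: 'a alg3)"
      using single_one[where 'a = "'a forest \<times> 'a forest \<times> 'a forest" and 'b = real]
      by (simp add: zero_prod_def)
    then show ?thesis by (simp add: coproduct_right_def)
  qed
  ultimately show ?case
    by (simp add: coproduct_Node linear_add[OF linear_coproduct_maps(2)]
        linear_add[OF linear_coproduct_maps(3)] linear_add[OF linear_coproduct_maps(4)]
        coproduct_left_tensor_id coproduct_right_tensor_id IH)
qed

lemmas coassociative = coassociative_forest[OF coassociative_tree]

text \<open>The convolution product dual to the coproduct. Chen's relation says that the functional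
  at \<open>(t, s)\<close> is the convolution of those at \<open>(t, u)\<close> and
  \<open>(u, s)\<close>.\<close>

definition convol :: "('l forest \<Rightarrow> real) \<Rightarrow> ('l forest \<Rightarrow> real) \<Rightarrow> 'l forest \<Rightarrow> real" where
  "convol f g F = lin_ext (\<lambda>(G, H). f G * g H) (coproduct (basis_elt F))"

text \<open>Both sides evaluate one functional on triples, \<open>f F * (g G * h H)\<close>, on an
  iterated coproduct, so coassociativity applies.\<close>

lemma convol_assoc: "convol (convol f g) h F = convol f (convol g h) F"
proof -
  let ?t = "lin_ext (\<lambda>(F, G, H). f F * (g G * h H))"
  have L: "?t (emb_left x * basis_elt ({#}, {#}, H)) = h H * lin_ext (\<lambda>(F, G). f F * g G) x" for x H
    unfolding mult.commute[of _ "basis_elt ({#}, {#}, H)"] emb_left_def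
      linear_comp_lin_ext[OF linear_times_pm] linear_comp_lin_ext[OF linear_lin_ext]
      linear_comp_lin_ext[OF linear_times]
    by (intro lin_ext_cong) (auto simp: mult_single)
  have R: "?t (basis_elt (F, {#}, {#}) * emb_right x) = f F * lin_ext (\<lambda>(G, H). g G * h H) x" for x F
    unfolding emb_right_def
      linear_comp_lin_ext[OF linear_times_pm] linear_comp_lin_ext[OF linear_lin_ext]
      linear_comp_lin_ext[OF linear_times]
    by (intro lin_ext_cong) (auto simp: mult_single)
  have "convol (convol f g) h F = ?t (coproduct_left (coproduct (basis_elt F)))"
    unfolding convol_def[of _ h] coproduct_left_def linear_comp_lin_ext[OF linear_lin_ext]
    by (intro lin_ext_cong) (auto simp: L convol_def)
  also have "\<dots> = convol f (convol g h) F"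
    unfolding coassociative convol_def[of f] coproduct_right_def linear_comp_lin_ext[OF linear_lin_ext]
    by (intro lin_ext_cong) (auto simp: R convol_def)
  finally show ?thesis .
qed

text \<open>As the coproduct is multiplicative, a convolution of characters is multiplicative
  again.\<close>

lemma convol_add:
  assumes "\<And>F G. f (F + G) = f F * f G" "\<And>F G. g (F + G) = g F * g G"
  shows "convol f g (F + G) = convol f g F * convol f g G"
  unfolding convol_def coproduct_basis_add
  by (rule lin_ext_mult_real) (auto simp: assms)

lemma convol_empty: "convol f g {#} = f {#} * g {#}"
  by (simp add: convol_def coproduct_1)

text \<open>For the empty forest the reduced coproduct is minus the unit, which keeps the formula
  correct there.\<close>

lemma convol_red_coproduct:
  "convol f g F = f {#} * g F + f F * g {#}
     + lin_ext (\<lambda>(G, H). f G * g H) (red_coproduct (basis_elt F))"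
  unfolding convol_def red_coproduct_def one_alg
  by (simp add: lin_ext_diff del: single_one)

lemma lin_ext_basis_elt: "lin_ext basis_elt x = x"
  unfolding lin_ext_def by (rule pm_as_sum[symmetric])

lemma linear_eq_lin_ext: "linear f \<Longrightarrow> f x = lin_ext (\<lambda>k. f (basis_elt k)) x"
  using linear_comp_lin_ext[of f basis_elt x] by (simp add: lin_ext_basis_elt)

section \<open>Positivity of the coproduct and of \<open>q\<close>\<close>

definition nonneg_coeffs :: "('k \<Rightarrow>\<^sub>0 real) \<Rightarrow> bool" where
  "nonneg_coeffs x \<longleftrightarrow> (\<forall>k. 0 \<le> Poly_Mapping.lookup x k)"

lemma nonneg_coeffs_basis: "nonneg_coeffs (basis_elt k)"
  by (simp add: nonneg_coeffs_def lookup_single when_def)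

lemma nonneg_coeffs_add: "nonneg_coeffs x \<Longrightarrow> nonneg_coeffs y \<Longrightarrow> nonneg_coeffs (x + y)"
  by (simp add: nonneg_coeffs_def lookup_add)

lemma nonneg_coeffs_lin_ext:
  assumes "nonneg_coeffs x" "\<And>k. nonneg_coeffs (f k)"
  shows "nonneg_coeffs (lin_ext f x)"
  using assms by (auto simp: nonneg_coeffs_def lin_ext_def lookup_sum lookup_scaleR_pm
      intro!: sum_nonneg mult_nonneg_nonneg)

lemma nonneg_coeffs_mult:
  fixes x y :: "'k::comm_monoid_add \<Rightarrow>\<^sub>0 real"
  assumes "nonneg_coeffs x" "nonneg_coeffs y"
  shows "nonneg_coeffs (x * y)"
proof -
  have "nonneg_coeffs (basis_elt l * x)" for l
    by (subst linear_eq_lin_ext[OF linear_times_pm])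
      (intro nonneg_coeffs_lin_ext assms(1), simp add: mult_single nonneg_coeffs_basis)
  then show ?thesis
    by (subst linear_eq_lin_ext[OF linear_times_pm])
      (intro nonneg_coeffs_lin_ext assms(2), simp add: mult.commute)
qed

lemma nonneg_coeffs_coproduct_tree: "nonneg_coeffs (coproduct_tree \<tau>)"
proof (induction \<tau>)
  case (Node a F)
  have "nonneg_coeffs (\<Prod>x\<in>#image_mset coproduct_tree F. x)"
    using Node
  proof (induction F)
    case empty
    then show ?case using nonneg_coeffs_basis[of 0] by simp
  qed (simp add: nonneg_coeffs_mult)
  then show ?case
    unfolding coproduct_tree.simps tensor_id_def one_alg
    by (intro nonneg_coeffs_add nonneg_coeffs_lin_ext)
      (auto simp: Bplus_basis nonneg_coeffs_basis simp del: single_one)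
qed

text \<open>The subtracted terms have an empty component and so do not affect the keys of the
  reduced coproduct, where the coefficients are those of \<Delta>. Positivity later lets bounds be
  summed termwise.\<close>

lemma red_coproduct_tree_nonneg:
  assumes "p \<in> Poly_Mapping.keys (red_coproduct (basis_elt {#\<tau>#}))"
  shows "0 \<le> Poly_Mapping.lookup (red_coproduct (basis_elt {#\<tau>#})) p"
proof -
  have "fst p \<noteq> {#}" "snd p \<noteq> {#}"
    using red_coproduct_tree_keys[of "fst p" "snd p" \<tau>] assms by simp_all
  then have "Poly_Mapping.lookup (red_coproduct (basis_elt {#\<tau>#})) p =
      Poly_Mapping.lookup (coproduct_tree \<tau>) p"
    by (auto simp: red_coproduct_def coproduct_basis lookup_minus one_alg lookup_single when_def
        simp del: single_one)
  then show ?thesis using nonneg_coeffs_coproduct_tree[of \<tau>] unfolding nonneg_coeffs_def by metis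
qed

text \<open>The recursion is entered only when \<open>\<gamma> * nverts \<tau> > 1\<close>, where
  its denominator is positive.\<close>

lemma q_tree_nonneg:
  fixes \<tau> :: "'l tree"
  assumes "\<gamma> > 0"
  shows "0 \<le> q_tree \<gamma> \<tau>"
proof (induction "nverts \<tau>" arbitrary: \<tau> rule: less_induct)
  case less
  have prod: "0 \<le> (\<Prod>\<sigma>\<in>#F. q_tree \<gamma> \<sigma>)" if "\<And>\<sigma>. \<sigma> \<in># F \<Longrightarrow> nverts \<sigma> < nverts \<tau>" for F :: "'l forest"
    using that by (induction F) (simp_all add: less.hyps)
  have "2 powr (\<gamma> * real (nverts \<tau>)) - 2 \<ge> 0" if "\<not> real (nverts \<tau>) \<le> 1 / \<gamma>"
    using powr_mono[of 1 "\<gamma> * real (nverts \<tau>)" 2] that assms by (simp add: field_simps)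
  moreover have "0 \<le> (\<Sum>p\<in>Poly_Mapping.keys (red_coproduct (basis_elt {#\<tau>#})).
      Poly_Mapping.lookup (red_coproduct (basis_elt {#\<tau>#})) p *
      ((\<Prod>\<sigma>\<in>#fst p. q_tree \<gamma> \<sigma>) * (\<Prod>\<sigma>\<in>#snd p. q_tree \<gamma> \<sigma>)))"
    by (intro sum_nonneg mult_nonneg_nonneg prod)
      (auto intro: red_coproduct_tree_less red_coproduct_tree_nonneg)
  ultimately show ?case by (subst q_tree.simps) simp
qed

lemma q_forest_nonneg: "\<gamma> > 0 \<Longrightarrow> 0 \<le> q_forest \<gamma> F"
  unfolding q_forest_def by (induction F) (auto simp: q_tree_nonneg)

lemma q_tree_large:
  assumes "\<gamma> > 0" "\<gamma> * real (nverts \<tau>) > 1"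
  shows "q_tree \<gamma> \<tau> =
    lin_ext (\<lambda>(F, G). q_forest \<gamma> F * q_forest \<gamma> G) (red_coproduct (basis_elt {#\<tau>#})) /
    (2 powr (\<gamma> * real (nverts \<tau>)) - 2)"
proof -
  have "\<not> real (nverts \<tau>) \<le> 1 / \<gamma>" using assms by (simp add: field_simps)
  then show ?thesis
    by (subst q_tree.simps) (simp add: q_forest_def lin_ext_def case_prod_beta)
qed

section \<open>Multiplicative extension of tree-indexed increments\<close>

definition forest_incr :: "('l tree \<Rightarrow> incr) \<Rightarrow> real \<Rightarrow> real \<Rightarrow> 'l forest \<Rightarrow> real" where
  "forest_incr v t s F = (\<Prod>\<tau>\<in>#F. v \<tau> t s)"

lemma forest_incr_simps [simp]:
  "forest_incr v t s {#} = 1"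
  "forest_incr v t s {#\<tau>#} = v \<tau> t s"
  "forest_incr v t s (add_mset \<tau> F) = v \<tau> t s * forest_incr v t s F"
  "forest_incr v t s (F + G) = forest_incr v t s F * forest_incr v t s G"
  by (simp_all add: forest_incr_def)

lemma forest_incr_cong:
  "(\<And>\<tau>. \<tau> \<in># F \<Longrightarrow> v \<tau> = w \<tau>) \<Longrightarrow> forest_incr v t s F = forest_incr w t s F"
  by (induction F) auto

text \<open>Chen's relation at one tree, stated through tree values alone, so that it can be used
  before a homomorphism is available.\<close>

definition chen_tree :: "real \<Rightarrow> ('l tree \<Rightarrow> incr) \<Rightarrow> 'l tree \<Rightarrow> bool" where
  "chen_tree T v \<tau> \<longleftrightarrow> (\<forall>t\<in>{0..T}. \<forall>u\<in>{0..T}. \<forall>s\<in>{0..T}.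
     delta (v \<tau>) t u s =
     lin_ext (\<lambda>(F, G). forest_incr v t u F * forest_incr v u s G) (red_coproduct (basis_elt {#\<tau>#})))"

text \<open>Only trees smaller than \<tau> occur in \<Delta>'\<tau>. Hence the right side of Chen's
  relation at \<tau> is fixed before \<open>v \<tau>\<close> is chosen.\<close>

lemma red_coproduct_forest_incr_cong:
  assumes "\<And>\<sigma>. nverts \<sigma> < nverts \<tau> \<Longrightarrow> v \<sigma> = w \<sigma>"
  shows "lin_ext (\<lambda>(F, G). forest_incr v t u F * forest_incr v u s G) (red_coproduct (basis_elt {#\<tau>#})) =
    lin_ext (\<lambda>(F, G). forest_incr w t u F * forest_incr w u s G) (red_coproduct (basis_elt {#\<tau>#}))"
proof (rule lin_ext_cong)
  fix p assume p: "p \<in> Poly_Mapping.keys (red_coproduct (basis_elt {#\<tau>#}))"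
  have "forest_incr v t u (fst p) = forest_incr w t u (fst p)"
    "forest_incr v u s (snd p) = forest_incr w u s (snd p)"
    using red_coproduct_tree_less[OF p] by (auto intro!: forest_incr_cong assms)
  then show "(case p of (F, G) \<Rightarrow> forest_incr v t u F * forest_incr v u s G) =
      (case p of (F, G) \<Rightarrow> forest_incr w t u F * forest_incr w u s G)"
    by (simp add: case_prod_beta)
qed

lemma chen_tree_cong:
  assumes "\<And>\<sigma>. nverts \<sigma> \<le> nverts \<tau> \<Longrightarrow> v \<sigma> = w \<sigma>"
  shows "chen_tree T v \<tau> \<longleftrightarrow> chen_tree T w \<tau>"
proof -
  have "v \<tau> = w \<tau>" by (rule assms) simp
  moreover have "lin_ext (\<lambda>(F, G). forest_incr v t u F * forest_incr v u s G) (red_coproduct (basis_elt {#\<tau>#})) =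
      lin_ext (\<lambda>(F, G). forest_incr w t u F * forest_incr w u s G) (red_coproduct (basis_elt {#\<tau>#}))"
    for t u s
    by (rule red_coproduct_forest_incr_cong, rule assms) simp
  ultimately show ?thesis by (simp only: chen_tree_def)
qed

lemma chen_treeD:
  assumes "chen_tree T v \<tau>" "t \<in> {0..T}" "u \<in> {0..T}" "s \<in> {0..T}"
  shows "delta (v \<tau>) t u s =
    lin_ext (\<lambda>(F, G). forest_incr v t u F * forest_incr v u s G) (red_coproduct (basis_elt {#\<tau>#}))"
  using assms unfolding chen_tree_def by blast

text \<open>With the full coproduct in place of the reduced one, both sides are multiplicative in
  the forest, so the relation passes from trees to forests.\<close>

lemma chen_forest:
  assumes "\<And>\<tau>. \<tau> \<in># F \<Longrightarrow> chen_tree T v \<tau>" and "t \<in> {0..T}" "u \<in> {0..T}" "s \<in> {0..T}"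
  shows "forest_incr v t s F = convol (forest_incr v t u) (forest_incr v u s) F"
  using assms(1)
proof (induction F)
  case empty
  then show ?case by (simp add: convol_empty)
next
  case (add \<tau> F)
  have "forest_incr v t s {#\<tau>#} = convol (forest_incr v t u) (forest_incr v u s) {#\<tau>#}"
    using chen_treeD[OF add.prems[of \<tau>] assms(2-)] by (simp add: convol_red_coproduct delta_def)
  then show ?case
    using add convol_add[of "forest_incr v t u" "forest_incr v u s" "{#\<tau>#}" F] by simp
qed

definition tree_hom :: "real \<Rightarrow> ('l tree \<Rightarrow> incr) \<Rightarrow> 'l alg \<Rightarrow> incr" where
  "tree_hom T v x t s =
     (if t \<in> {0..T} \<and> s \<in> {0..T} then lin_ext (forest_incr v t s) x else 0)"

lemma tree_hom_tree:
  assumes "v \<tau> \<in> C2 T"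
  shows "tree_hom T v (basis_elt {#\<tau>#}) = v \<tau>"
  using assms by (auto simp: fun_eq_iff tree_hom_def C2_def)

lemma homomorphism_tree_hom:
  assumes v: "\<And>\<tau>. v \<tau> \<in> C2 T"
  shows "homomorphism T (tree_hom T v)"
proof -
  \<comment> \<open>Trees vanish on the diagonal, so only the empty forest survives. Its coefficient
    is the multiple of the unit in the decomposition of \<open>C2_plus\<close>.\<close>
  have diag: "lin_ext (forest_incr v t t) x = Poly_Mapping.lookup x {#}" if "t \<in> {0..T}" for t x
  proof -
    have "forest_incr v t t F = (if F = {#} then 1 else 0)" for F
      using v that by (cases F) (auto simp: C2_def)
    then have "forest_incr v t t = (\<lambda>F. if F = {#} then 1 else 0)" by (rule ext)
    then have "lin_ext (forest_incr v t t) x =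
        (\<Sum>F\<in>Poly_Mapping.keys x. if F = {#} then Poly_Mapping.lookup x F else 0)"
      unfolding lin_ext_def by (intro sum.cong) auto
    then show ?thesis by (simp add: in_keys_iff)
  qed
  have "tree_hom T v x \<in> C2_plus T" for x
    unfolding C2_plus_def
  proof (rule CollectI, intro exI conjI)
    let ?c = "Poly_Mapping.lookup x {#}"
    let ?g = "\<lambda>t s. tree_hom T v x t s - ?c * unit_incr T t s"
    show "tree_hom T v x = (\<lambda>t s. ?g t s + ?c * unit_incr T t s)" by simp
    show "?g \<in> C2 T" by (auto simp: C2_def tree_hom_def unit_incr_def diag)
  qed
  moreover have "tree_hom T v (x * y) = (\<lambda>t s. tree_hom T v x t s * tree_hom T v y t s)" for x y
    by (auto simp: fun_eq_iff tree_hom_def lin_ext_mult_real)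
  moreover have "tree_hom T v 1 = unit_incr T"
    by (auto simp: fun_eq_iff tree_hom_def unit_incr_def one_alg simp del: single_one)
  moreover have "tree_hom T v (x + y) = (\<lambda>t s. tree_hom T v x t s + tree_hom T v y t s)" for x y
    by (auto simp: fun_eq_iff tree_hom_def lin_ext_add)
  moreover have "tree_hom T v (c *\<^sub>R x) = (\<lambda>t s. c * tree_hom T v x t s)" for c x
    by (auto simp: fun_eq_iff tree_hom_def linear_scale[OF linear_lin_ext])
  ultimately show ?thesis
    using v by (simp add: hom_on_def tree_hom_tree)
qed

lemma red_coproduct_eq:
  "red_coproduct x = coproduct x - lin_ext (\<lambda>F. basis_elt ({#}, F)) x - lin_ext (\<lambda>F. basis_elt (F, {#})) x"
  unfolding red_coproduct_def tensor_def one_alg by (simp del: single_one)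

lemma linear_red_coproduct: "linear red_coproduct"
  unfolding red_coproduct_eq[abs_def]
  by (intro linear_compose_sub linear_coproduct linear_lin_ext)

text \<open>Both sides are linear in the algebra element, so \<open>chen_forest\<close> on basis
  elements suffices.\<close>

lemma chen_on_tree_hom:
  assumes v: "\<And>\<tau>. chen_tree T v \<tau>"
  shows "chen_on T UNIV (tree_hom T v)"
  unfolding chen_on_def
proof (intro ballI)
  fix x and t u s assume tus: "t \<in> {0..T}" "u \<in> {0..T}" "s \<in> {0..T}"
  let ?f = "lin_ext (\<lambda>(F, G). forest_incr v t u F * forest_incr v u s G)"
  have "(\<lambda>x. lin_ext (forest_incr v t s) x - lin_ext (forest_incr v t u) x - lin_ext (forest_incr v u s) x)
      = ?f \<circ> red_coproduct"
  proof (intro linear_eq_on_basis_elt linear_compose_sub linear_lin_ext linear_compose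
      linear_red_coproduct)
    fix F
    show "lin_ext (forest_incr v t s) (basis_elt F) - lin_ext (forest_incr v t u) (basis_elt F) -
        lin_ext (forest_incr v u s) (basis_elt F) = (?f \<circ> red_coproduct) (basis_elt F)"
      using chen_forest[OF v tus, of F] by (simp add: convol_red_coproduct)
  qed
  then show "delta (tree_hom T v x) t u s = on_tensor (tree_hom T v) (red_coproduct x) t u s"
    using tus by (simp add: fun_eq_iff delta_def tree_hom_def on_tensor_def ext_prod_def)
qed

section \<open>Homomorphisms are determined by their values on trees\<close>

lemma hom_on_subset: "hom_on T V X \<Longrightarrow> W \<subseteq> V \<Longrightarrow> hom_on T W X"
  unfolding hom_on_def by blast

lemma basis_in_alg_upto: "fdeg F \<le> n \<Longrightarrow> basis_elt F \<in> alg_upto n"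
  unfolding alg_upto_def by (intro span_base) auto

lemma subspace_alg_upto: "subspace (alg_upto n)"
  unfolding alg_upto_def by (rule subspace_span)

lemma ex_alg_upto: "\<exists>n. x \<in> alg_upto n"
proof -
  let ?n = "\<Sum>F\<in>Poly_Mapping.keys x. fdeg F"
  have "fdeg F \<le> ?n" if "F \<in> Poly_Mapping.keys x" for F
    using that by (intro member_le_sum) auto
  then have "(\<Sum>k\<in>Poly_Mapping.keys x. Poly_Mapping.lookup x k *\<^sub>R basis_elt k) \<in> alg_upto ?n"
    by (intro subspace_sum subspace_scale subspace_alg_upto basis_in_alg_upto)
  then show ?thesis using pm_as_sum[of x] by auto
qed

text \<open>Subforests of \<open>F\<close> also have degree at most \<open>n\<close>, so factors can
  be split off one tree at a time inside \<open>alg_upto n\<close>.\<close>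

lemma hom_on_forest:
  assumes X: "hom_on T (alg_upto n) X" and "t \<in> {0..T}" "s \<in> {0..T}" and "fdeg F \<le> n"
  shows "X (basis_elt F) t s = forest_incr (\<lambda>\<tau>. X (basis_elt {#\<tau>#})) t s F"
  using assms(4)
proof (induction F)
  case empty
  then show ?case using X assms(2,3) by (simp add: hom_on_def unit_incr_def)
next
  case (add \<tau> F)
  have e: "basis_elt (add_mset \<tau> F) = basis_elt {#\<tau>#} * basis_elt F" by (simp add: mult_single)
  have "basis_elt (add_mset \<tau> F) \<in> alg_upto n" "basis_elt {#\<tau>#} \<in> alg_upto n" "basis_elt F \<in> alg_upto n"
    using add.prems by (auto intro!: basis_in_alg_upto)
  then have "X (basis_elt (add_mset \<tau> F)) =
      (\<lambda>t s. X (basis_elt {#\<tau>#}) t s * X (basis_elt F) t s)"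
    using X unfolding hom_on_def e by blast
  then show ?case using add by simp
qed

lemma hom_on_outside:
  assumes "hom_on T V X" "x \<in> V" "\<not> (t \<in> {0..T} \<and> s \<in> {0..T})"
  shows "X x t s = 0"
proof -
  have "X x \<in> C2_plus T" using assms(1,2) by (simp add: hom_on_def)
  then show ?thesis using assms(3) by (auto simp: C2_plus_def C2_def unit_incr_def)
qed

lemma hom_on_eqI:
  assumes X: "hom_on T (alg_upto n) X" and Y: "hom_on T (alg_upto n) Y"
    and trees: "\<And>\<tau>. nverts \<tau> \<le> n \<Longrightarrow> X (basis_elt {#\<tau>#}) = Y (basis_elt {#\<tau>#})"
    and x: "x \<in> alg_upto n"
  shows "X x = Y x"
proof -
  have forests: "X (basis_elt F) = Y (basis_elt F)" if F: "fdeg F \<le> n" for F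
  proof (intro ext)
    fix t s
    show "X (basis_elt F) t s = Y (basis_elt F) t s"
    proof (cases "t \<in> {0..T} \<and> s \<in> {0..T}")
      case True
      have "forest_incr (\<lambda>\<tau>. X (basis_elt {#\<tau>#})) t s F = forest_incr (\<lambda>\<tau>. Y (basis_elt {#\<tau>#})) t s F"
        by (rule forest_incr_cong, rule trees, rule order_trans[OF nverts_le_fdeg F])
      then show ?thesis using True X Y F by (simp add: hom_on_forest)
    next
      case False
      then show ?thesis
        using hom_on_outside[OF X basis_in_alg_upto[OF F]] hom_on_outside[OF Y basis_in_alg_upto[OF F]]
        by simp
    qed
  qed
  note V = subspace_alg_upto[of n]
  have add: "Z (x + y) = (\<lambda>t s. Z x t s + Z y t s)"
    and scale: "Z (c *\<^sub>R x) = (\<lambda>t s. c * Z x t s)"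
    if "hom_on T (alg_upto n) Z" "x \<in> alg_upto n" "y \<in> alg_upto n" for Z x y c
    using that unfolding hom_on_def by blast+
  have zero: "Z 0 = (\<lambda>t s. 0)" if "hom_on T (alg_upto n) Z" for Z
    using scale[OF that, of 0 0 0] subspace_0[OF V] by simp
  \<comment> \<open>Nothing is known about additivity outside \<open>alg_upto n\<close>, so the
    subspace of agreement is formed inside it.\<close>
  have "span (basis_elt ` {F. fdeg F \<le> n}) \<subseteq> {x \<in> alg_upto n. X x = Y x}"
  proof (rule span_minimal)
    show "basis_elt ` {F. fdeg F \<le> n} \<subseteq> {x \<in> alg_upto n. X x = Y x}"
      by (auto simp: forests basis_in_alg_upto)
    show "subspace {x \<in> alg_upto n. X x = Y x}"
    proof (rule subspaceI)
      show "0 \<in> {x \<in> alg_upto n. X x = Y x}"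
        by (simp add: zero[OF X] zero[OF Y] subspace_0[OF V])
    next
      fix x y assume "x \<in> {x \<in> alg_upto n. X x = Y x}" "y \<in> {x \<in> alg_upto n. X x = Y x}"
      then show "x + y \<in> {x \<in> alg_upto n. X x = Y x}"
        using add[OF X] add[OF Y] subspace_add[OF V] by auto
    next
      fix c x assume "x \<in> {x \<in> alg_upto n. X x = Y x}"
      then show "c *\<^sub>R x \<in> {x \<in> alg_upto n. X x = Y x}"
        using scale[OF X] scale[OF Y] subspace_scale[OF V] by auto
    qed
  qed
  then show ?thesis using x by (auto simp: alg_upto_def)
qed

lemma chen_tree_of_hom:
  assumes X: "hom_on T (alg_upto n) X" and chen: "chen_on T (alg_upto n) X" and \<tau>: "nverts \<tau> \<le> n"
  shows "chen_tree T (\<lambda>\<sigma>. X (basis_elt {#\<sigma>#})) \<tau>"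
  unfolding chen_tree_def
proof (intro ballI)
  fix t u s assume tus: "t \<in> {0..T}" "u \<in> {0..T}" "s \<in> {0..T}"
  have "delta (X (basis_elt {#\<tau>#})) t u s = on_tensor X (red_coproduct (basis_elt {#\<tau>#})) t u s"
    using chen tus \<tau> basis_in_alg_upto[of "{#\<tau>#}" n] by (simp add: chen_on_def)
  also have "\<dots> = lin_ext (\<lambda>(F, G). forest_incr (\<lambda>\<sigma>. X (basis_elt {#\<sigma>#})) t u F *
      forest_incr (\<lambda>\<sigma>. X (basis_elt {#\<sigma>#})) u s G) (red_coproduct (basis_elt {#\<tau>#}))"
    unfolding on_tensor_def
  proof (rule lin_ext_cong, clarify)
    fix F G assume "(F, G) \<in> Poly_Mapping.keys (red_coproduct (basis_elt {#\<tau>#}))"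
    then have "fdeg F + fdeg G = nverts \<tau>" by (rule red_coproduct_tree_keys)
    then show "ext_prod (X (basis_elt F)) (X (basis_elt G)) t u s =
        forest_incr (\<lambda>\<sigma>. X (basis_elt {#\<sigma>#})) t u F * forest_incr (\<lambda>\<sigma>. X (basis_elt {#\<sigma>#})) u s G"
      using X tus \<tau> by (simp add: ext_prod_def hom_on_forest)
  qed
  finally show "delta (X (basis_elt {#\<tau>#})) t u s = \<dots>" .
qed

section \<open>Extension and uniqueness on a single tree\<close>

lemma hoelder_norm_le_iff:
  "hoelder_norm T \<mu> f \<le> ereal c \<longleftrightarrow>
     (\<forall>t\<in>{0..T}. \<forall>s\<in>{0..T}. s \<noteq> t \<longrightarrow> \<bar>f t s\<bar> \<le> c * \<bar>t - s\<bar> powr \<mu>)"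
proof -
  have "\<bar>f t s\<bar> / \<bar>t - s\<bar> powr \<mu> \<le> c \<longleftrightarrow> \<bar>f t s\<bar> \<le> c * \<bar>t - s\<bar> powr \<mu>" if "s \<noteq> t" for t s
    using that by (simp add: divide_le_eq)
  then show ?thesis by (auto simp: hoelder_norm_def SUP_le_iff)
qed

lemma C2_hoelder_bound:
  assumes "f \<in> C2 T" "hoelder_norm T \<mu> f \<le> ereal c" "t \<in> {0..T}" "s \<in> {0..T}"
  shows "\<bar>f t s\<bar> \<le> c * \<bar>t - s\<bar> powr \<mu>"
proof (cases "s = t")
  case True
  then show ?thesis using assms by (simp add: C2_def)
next
  case False
  then show ?thesis using assms by (simp add: hoelder_norm_le_iff)
qed

text \<open>Each tree brings a factor \<open>B\<close>, and \<open>B \<le> 1\<close> lets all but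
  one be dropped. The empty forest is excluded: its value 1 need not be bounded by
  \<open>B\<close>.\<close>

lemma forest_incr_bound:
  assumes \<gamma>: "\<gamma> > 0" and A: "A \<ge> 0" and B: "0 \<le> B" "B \<le> 1" and "F \<noteq> {#}"
    and bd: "\<And>\<tau>. \<tau> \<in># F \<Longrightarrow>
      \<bar>v \<tau> t s\<bar> \<le> B * A ^ nverts \<tau> * q_tree \<gamma> \<tau> * \<bar>t - s\<bar> powr (\<gamma> * real (nverts \<tau>))"
  shows "\<bar>forest_incr v t s F\<bar> \<le> B * A ^ fdeg F * q_forest \<gamma> F * \<bar>t - s\<bar> powr (\<gamma> * real (fdeg F))"
  using assms(5) bd
proof (induction F)
  case (add \<tau> F)
  define a where "a = A ^ nverts \<tau> * q_tree \<gamma> \<tau> * \<bar>t - s\<bar> powr (\<gamma> * real (nverts \<tau>))"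
  define b where "b = A ^ fdeg F * q_forest \<gamma> F * \<bar>t - s\<bar> powr (\<gamma> * real (fdeg F))"
  have a: "a \<ge> 0" and b: "b \<ge> 0"
    using A q_tree_nonneg[OF \<gamma>, of \<tau>] q_forest_nonneg[OF \<gamma>, of F] by (simp_all add: a_def b_def)
  have \<tau>: "\<bar>v \<tau> t s\<bar> \<le> B * a" using add.prems(2)[of \<tau>] by (simp add: a_def mult_ac)
  show ?case
  proof (cases "F = {#}")
    case True
    then show ?thesis using add.prems(2)[of \<tau>] by (simp add: q_forest_def)
  next
    case False
    then have "\<bar>forest_incr v t s F\<bar> \<le> B * b"
      using add by (simp add: b_def mult_ac)
    then have "\<bar>v \<tau> t s * forest_incr v t s F\<bar> \<le> (B * a) * (B * b)"
      unfolding abs_mult using \<tau> a b B by (intro mult_mono) auto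
    also have "\<dots> = B * (B * (a * b))" by (simp add: mult_ac)
    also have "\<dots> \<le> 1 * (B * (a * b))" using a b B by (intro mult_right_mono) auto
    also have "\<dots> = B * A ^ fdeg (add_mset \<tau> F) * q_forest \<gamma> (add_mset \<tau> F) *
        \<bar>t - s\<bar> powr (\<gamma> * real (fdeg (add_mset \<tau> F)))"
      by (simp add: a_def b_def q_forest_def power_add distrib_left powr_add mult_ac)
    finally show ?thesis by simp
  qed
qed simp

text \<open>In each term of \<Delta>'\<tau> the two degrees add up to \<open>nverts \<tau>\<close>,
  so the powers of \<open>A\<close> and \<open>M\<close> combine, while
  \<open>B * B \<le> B\<close>. Keeping \<open>M\<close> free serves both sewing and midpoint
  splitting.\<close>

lemma red_coproduct_bound:
  assumes \<gamma>: "\<gamma> > 0" and A: "A \<ge> 0" and B: "0 \<le> B" "B \<le> 1"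
    and bd: "\<And>\<sigma> t s. nverts \<sigma> < nverts \<tau> \<Longrightarrow> t \<in> {0..T} \<Longrightarrow> s \<in> {0..T} \<Longrightarrow>
      \<bar>v \<sigma> t s\<bar> \<le> B * A ^ nverts \<sigma> * q_tree \<gamma> \<sigma> * \<bar>t - s\<bar> powr (\<gamma> * real (nverts \<sigma>))"
    and tus: "t \<in> {0..T}" "u \<in> {0..T}" "s \<in> {0..T}" and M: "\<bar>t - u\<bar> \<le> M" "\<bar>u - s\<bar> \<le> M"
  shows "\<bar>lin_ext (\<lambda>(F, G). forest_incr v t u F * forest_incr v u s G) (red_coproduct (basis_elt {#\<tau>#}))\<bar>
    \<le> B * A ^ nverts \<tau> *
      lin_ext (\<lambda>(F, G). q_forest \<gamma> F * q_forest \<gamma> G) (red_coproduct (basis_elt {#\<tau>#})) *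
      M powr (\<gamma> * real (nverts \<tau>))"
proof -
  let ?r = "red_coproduct (basis_elt {#\<tau>#})"
  have summand: "\<bar>forest_incr v t u F * forest_incr v u s G\<bar> \<le>
      B * A ^ nverts \<tau> * M powr (\<gamma> * real (nverts \<tau>)) * (q_forest \<gamma> F * q_forest \<gamma> G)"
    if p: "(F, G) \<in> Poly_Mapping.keys ?r" for F G
  proof -
    have FG: "fdeg F + fdeg G = nverts \<tau>" "F \<noteq> {#}" "G \<noteq> {#}"
      using red_coproduct_tree_keys[OF p] by auto
    have b: "\<bar>forest_incr v x y H\<bar> \<le> B * A ^ fdeg H * q_forest \<gamma> H * M powr (\<gamma> * real (fdeg H))"
      if "H = F \<or> H = G" "x \<in> {0..T}" "y \<in> {0..T}" "\<bar>x - y\<bar> \<le> M" for H x y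
    proof -
      have "\<bar>forest_incr v x y H\<bar> \<le> B * A ^ fdeg H * q_forest \<gamma> H * \<bar>x - y\<bar> powr (\<gamma> * real (fdeg H))"
        using that FG red_coproduct_tree_less[OF p]
        by (intro forest_incr_bound[OF \<gamma> A B] bd) auto
      also have "\<dots> \<le> B * A ^ fdeg H * q_forest \<gamma> H * M powr (\<gamma> * real (fdeg H))"
        using that A B \<gamma> q_forest_nonneg[OF \<gamma>, of H]
        by (intro mult_left_mono powr_mono2 mult_nonneg_nonneg) auto
      finally show ?thesis .
    qed
    let ?a = "\<lambda>H. A ^ fdeg H * q_forest \<gamma> H * M powr (\<gamma> * real (fdeg H))"
    have a: "?a H \<ge> 0" for H using A q_forest_nonneg[OF \<gamma>, of H] by simp
    have "\<bar>forest_incr v t u F\<bar> \<le> B * ?a F" "\<bar>forest_incr v u s G\<bar> \<le> B * ?a G"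
      using b[of F t u] b[of G u s] tus M by (simp_all add: mult.assoc)
    then have "\<bar>forest_incr v t u F * forest_incr v u s G\<bar> \<le> (B * ?a F) * (B * ?a G)"
      unfolding abs_mult using mult_nonneg_nonneg[OF B(1) a[of F]] by (intro mult_mono) auto
    also have "\<dots> = B * (B * (?a F * ?a G))" by (simp add: mult_ac)
    also have "\<dots> \<le> 1 * (B * (?a F * ?a G))"
      by (rule mult_right_mono[OF B(2) mult_nonneg_nonneg[OF B(1) mult_nonneg_nonneg[OF a a]]])
    also have "\<dots> = B * A ^ nverts \<tau> * M powr (\<gamma> * real (nverts \<tau>)) * (q_forest \<gamma> F * q_forest \<gamma> G)"
      unfolding FG(1)[symmetric] by (simp add: power_add distrib_left powr_add mult_ac)
    finally show ?thesis .
  qed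
  let ?c = "B * A ^ nverts \<tau> * M powr (\<gamma> * real (nverts \<tau>))"
  let ?f = "\<lambda>p. forest_incr v t u (fst p) * forest_incr v u s (snd p)"
  have "\<bar>lin_ext ?f ?r\<bar> \<le> (\<Sum>p\<in>Poly_Mapping.keys ?r. \<bar>Poly_Mapping.lookup ?r p * ?f p\<bar>)"
    unfolding lin_ext_def real_scaleR_def by (rule sum_abs)
  also have "\<dots> \<le> (\<Sum>p\<in>Poly_Mapping.keys ?r. Poly_Mapping.lookup ?r p *
      (?c * (q_forest \<gamma> (fst p) * q_forest \<gamma> (snd p))))"
  proof (rule sum_mono)
    fix p assume p: "p \<in> Poly_Mapping.keys ?r"
    have "\<bar>?f p\<bar> \<le> ?c * (q_forest \<gamma> (fst p) * q_forest \<gamma> (snd p))"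
      using summand[of "fst p" "snd p"] p by simp
    then show "\<bar>Poly_Mapping.lookup ?r p * ?f p\<bar> \<le>
        Poly_Mapping.lookup ?r p * (?c * (q_forest \<gamma> (fst p) * q_forest \<gamma> (snd p)))"
      unfolding abs_mult[of "Poly_Mapping.lookup ?r p"] abs_of_nonneg[OF red_coproduct_tree_nonneg[OF p]]
      by (rule mult_left_mono[OF _ red_coproduct_tree_nonneg[OF p]])
  qed
  also have "\<dots> = ?c * lin_ext (\<lambda>(F, G). q_forest \<gamma> F * q_forest \<gamma> G) ?r"
    unfolding lin_ext_def sum_distrib_left by (intro sum.cong) (auto simp: mult_ac)
  finally show ?thesis by (simp add: case_prod_unfold mult_ac)
qed

text \<open>This is associativity of convolution at \<tau>: within \<Delta>'\<tau> the inner
  convolutions act on smaller trees, where Chen's relation collapses them.\<close>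

lemma red_coproduct_cocycle:
  assumes chen: "\<And>\<sigma>. nverts \<sigma> < nverts \<tau> \<Longrightarrow> chen_tree T v \<sigma>"
    and tusp: "t \<in> {0..T}" "u \<in> {0..T}" "s \<in> {0..T}" "p \<in> {0..T}"
  defines "h \<equiv> \<lambda>t u s. lin_ext (\<lambda>(F, G). forest_incr v t u F * forest_incr v u s G)
    (red_coproduct (basis_elt {#\<tau>#}))"
  shows "h t u s + h t s p = h u s p + h t u p"
proof -
  \<comment> \<open>Changing \<open>v\<close> to zero on \<open>\<tau>\<close> makes \<open>h t u s\<close> the convolution of the two characters at \<open>\<tau>\<close>.\<close>
  define w where "w = v(\<tau> := \<lambda>_ _. 0)"
  let ?a = "forest_incr w"
  let ?r = "red_coproduct (basis_elt {#\<tau>#})"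
  have h': "h t u s = lin_ext (\<lambda>(F, G). ?a t u F * ?a u s G) ?r" for t u s
    unfolding h_def by (rule red_coproduct_forest_incr_cong) (auto simp: w_def)
  have w0: "w \<tau> = (\<lambda>_ _. 0)" by (simp add: w_def)
  have h: "h t u s = convol (?a t u) (?a u s) {#\<tau>#}" for t u s
    by (simp add: h' convol_red_coproduct w0)
  have chen_w: "?a t s F = convol (?a t u) (?a u s) F"
    if "\<And>\<sigma>. \<sigma> \<in># F \<Longrightarrow> nverts \<sigma> < nverts \<tau>" "t \<in> {0..T}" "u \<in> {0..T}" "s \<in> {0..T}" for t u s F
  proof (rule chen_forest[OF _ that(2-)])
    fix \<sigma> assume "\<sigma> \<in># F"
    then have \<sigma>: "nverts \<sigma> < nverts \<tau>" by (rule that(1))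
    have "chen_tree T w \<sigma> = chen_tree T v \<sigma>"
      by (rule chen_tree_cong) (use \<sigma> in \<open>auto simp: w_def\<close>)
    then show "chen_tree T w \<sigma>" using chen[OF \<sigma>] by simp
  qed
  have "lin_ext (\<lambda>(G, H). convol (?a t u) (?a u s) G * ?a s p H) ?r = h t s p"
    unfolding h'
  proof (rule lin_ext_cong, clarify)
    fix G H assume "(G, H) \<in> Poly_Mapping.keys ?r"
    from red_coproduct_tree_less[OF this] show "convol (?a t u) (?a u s) G * ?a s p H = ?a t s G * ?a s p H"
      using tusp by (subst chen_w[of _ t u s]) auto
  qed
  \<comment> \<open>Of the two outer terms at \<tau>, one vanishes with \<open>w \<tau>\<close> and
    the other is \<open>h t u s\<close>.\<close>
  then have "convol (convol (?a t u) (?a u s)) (?a s p) {#\<tau>#} = h t u s + h t s p"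
    by (simp add: convol_red_coproduct[of "convol _ _"] convol_empty h w0)
  moreover have "lin_ext (\<lambda>(G, H). ?a t u G * convol (?a u s) (?a s p) H) ?r = h t u p"
    unfolding h'
  proof (rule lin_ext_cong, clarify)
    fix G H assume "(G, H) \<in> Poly_Mapping.keys ?r"
    from red_coproduct_tree_less[OF this] show "?a t u G * convol (?a u s) (?a s p) H = ?a t u G * ?a u p H"
      using tusp by (subst chen_w[of _ u s p]) auto
  qed
  then have "convol (?a t u) (convol (?a u s) (?a s p)) {#\<tau>#} = h u s p + h t u p"
    by (simp add: convol_red_coproduct[of _ "convol _ _"] convol_empty h w0)
  ultimately show ?thesis by (simp add: convol_assoc)
qed

lemma extend_to_tree:
  assumes T: "T > 0" and \<gamma>: "\<gamma> > 0" and A: "A \<ge> 0" and B: "0 \<le> B" "B \<le> 1"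
    and large: "\<gamma> * real (nverts \<tau>) > 1"
    and chen: "\<And>\<sigma>. nverts \<sigma> < nverts \<tau> \<Longrightarrow> chen_tree T v \<sigma>"
    and bd: "\<And>\<sigma> t s. nverts \<sigma> < nverts \<tau> \<Longrightarrow> t \<in> {0..T} \<Longrightarrow> s \<in> {0..T} \<Longrightarrow>
      \<bar>v \<sigma> t s\<bar> \<le> B * A ^ nverts \<sigma> * q_tree \<gamma> \<sigma> * \<bar>t - s\<bar> powr (\<gamma> * real (nverts \<sigma>))"
  shows "\<exists>g\<in>C2 T. chen_tree T (v(\<tau> := g)) \<tau> \<and>
    (\<forall>t\<in>{0..T}. \<forall>s\<in>{0..T}.
      \<bar>g t s\<bar> \<le> B * A ^ nverts \<tau> * q_tree \<gamma> \<tau> * \<bar>t - s\<bar> powr (\<gamma> * real (nverts \<tau>)))"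
proof -
  let ?z = "\<gamma> * real (nverts \<tau>)"
  let ?r = "red_coproduct (basis_elt {#\<tau>#})"
  define h where "h t u s = lin_ext (\<lambda>(F, G). forest_incr v t u F * forest_incr v u s G) ?r" for t u s
  define Q where "Q = lin_ext (\<lambda>(F, G). q_forest \<gamma> F * q_forest \<gamma> G) ?r"
  have Q: "Q \<ge> 0"
    unfolding Q_def lin_ext_def
    by (auto intro!: sum_nonneg mult_nonneg_nonneg red_coproduct_tree_nonneg q_forest_nonneg \<gamma>)
  let ?C = "B * A ^ nverts \<tau> * Q"
  have C: "?C \<ge> 0" using A B Q by simp
  have hbd: "\<bar>h t u s\<bar> \<le> ?C * M powr ?z"
    if "t \<in> {0..T}" "u \<in> {0..T}" "s \<in> {0..T}" "\<bar>t - u\<bar> \<le> M" "\<bar>u - s\<bar> \<le> M" for t u s M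
    unfolding h_def Q_def using \<gamma> A B bd that by (rule red_coproduct_bound)
  have cocycle: "h t u s + h t s p = h u s p + h t u p"
    if "t \<in> {0..T}" "u \<in> {0..T}" "s \<in> {0..T}" "p \<in> {0..T}" for t u s p
    unfolding h_def using chen that by (rule red_coproduct_cocycle)
  define g0 where "g0 t s = - h t s 0" for t s
  have g0: "g0 t s - g0 t u - g0 u s = h t u s"
    if "t \<in> {0..T}" "u \<in> {0..T}" "s \<in> {0..T}" for t u s
    using cocycle[of t u s 0] that T by (simp add: g0_def)
  have "\<bar>g0 t s - g0 t u - g0 u s\<bar> \<le> ?C * M powr ?z"
    if "t \<in> {0..T}" "u \<in> {0..T}" "s \<in> {0..T}" "\<bar>t - u\<bar> \<le> M" "\<bar>u - s\<bar> \<le> M" for t u s M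
    unfolding g0[OF that(1-3)] using that by (rule hbd)
  then obtain f K where fK: "\<And>t s. t \<in> {0..T} \<Longrightarrow> s \<in> {0..T} \<Longrightarrow>
      \<bar>g0 t s - (f t - f s)\<bar> \<le> K * \<bar>t - s\<bar> powr ?z"
    using sewing_exists[OF T large C] by metis
  \<comment> \<open>Subtracting the increment of a path leaves the defect unchanged; the value 0 off
    the square is required by \<open>C2\<close>.\<close>
  define g where "g t s = (if t \<in> {0..T} \<and> s \<in> {0..T} then g0 t s - (f t - f s) else 0)" for t s
  have gh: "g t s - g t u - g u s = h t u s"
    if "t \<in> {0..T}" "u \<in> {0..T}" "s \<in> {0..T}" for t u s
    using g0[OF that] that by (simp add: g_def)
  have gbd: "\<bar>g t s\<bar> \<le> B * A ^ nverts \<tau> * q_tree \<gamma> \<tau> * \<bar>t - s\<bar> powr ?z"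
    if "t \<in> {0..T}" "s \<in> {0..T}" for t s
  proof -
    \<comment> \<open>Sewing gives only some constant \<open>K\<close>; halving replaces it by the
      one built into \<open>q_tree\<close>.\<close>
    have "\<bar>g t s\<bar> \<le> ?C / (2 powr ?z - 2) * \<bar>t - s\<bar> powr ?z"
    proof (rule bound_by_midpoint_defect[OF large C])
      show "\<bar>g t s\<bar> \<le> K * \<bar>t - s\<bar> powr ?z" if "t \<in> {0..T}" "s \<in> {0..T}" for t s
        using fK[OF that] that by (simp add: g_def)
      show "\<bar>g t s - g t ((t + s) / 2) - g ((t + s) / 2) s\<bar> \<le> ?C * (\<bar>t - s\<bar> / 2) powr ?z"
        if "t \<in> {0..T}" "s \<in> {0..T}" for t s
      proof -
        have m: "(t + s) / 2 \<in> {0..T}" using that by auto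
        have "\<bar>t - (t + s) / 2\<bar> \<le> \<bar>t - s\<bar> / 2" "\<bar>(t + s) / 2 - s\<bar> \<le> \<bar>t - s\<bar> / 2"
          by (auto simp: abs_if field_simps)
        then show ?thesis unfolding gh[OF that(1) m that(2)] by (rule hbd[OF that(1) m that(2)])
      qed
    qed (use that in auto)
    then show ?thesis by (simp add: q_tree_large[OF \<gamma> large] Q_def)
  qed
  show ?thesis
  proof (intro bexI conjI ballI)
    show "g \<in> C2 T"
      unfolding C2_def
    proof (intro CollectI conjI ballI allI impI)
      \<comment> \<open>The bound forces this because \<open>0 powr z = 0\<close>.\<close>
      show "g t t = 0" if "t \<in> {0..T}" for t using gbd[OF that that] by simp
    qed (auto simp: g_def)
    show "chen_tree T (v(\<tau> := g)) \<tau>"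
      unfolding chen_tree_def
    proof (intro ballI)
      fix t u s assume tus: "t \<in> {0..T}" "u \<in> {0..T}" "s \<in> {0..T}"
      have "h t u s = lin_ext (\<lambda>(F, G). forest_incr (v(\<tau> := g)) t u F * forest_incr (v(\<tau> := g)) u s G) ?r"
        unfolding h_def by (rule red_coproduct_forest_incr_cong) auto
      then show "delta ((v(\<tau> := g)) \<tau>) t u s =
          lin_ext (\<lambda>(F, G). forest_incr (v(\<tau> := g)) t u F * forest_incr (v(\<tau> := g)) u s G) ?r"
        using gh[OF tus] by (simp add: delta_def)
    qed
  qed (fact gbd)
qed

text \<open>Agreement on smaller trees gives both increments the same defect at \<tau>. Their
  difference has defect 0, and the midpoint bound with \<open>C = 0\<close> makes it vanish.\<close>

lemma tree_incr_unique:
  assumes v: "v \<tau> \<in> C2 T" "chen_tree T v \<tau>" and w: "w \<tau> \<in> C2 T" "chen_tree T w \<tau>"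
    and eq: "\<And>\<sigma>. nverts \<sigma> < nverts \<tau> \<Longrightarrow> v \<sigma> = w \<sigma>" and z: "z > 1"
    and v_bd: "\<And>t s. t \<in> {0..T} \<Longrightarrow> s \<in> {0..T} \<Longrightarrow> \<bar>v \<tau> t s\<bar> \<le> K * \<bar>t - s\<bar> powr z"
    and w_bd: "\<And>t s. t \<in> {0..T} \<Longrightarrow> s \<in> {0..T} \<Longrightarrow> \<bar>w \<tau> t s\<bar> \<le> K * \<bar>t - s\<bar> powr z"
  shows "v \<tau> = w \<tau>"
proof (intro ext)
  fix t s
  show "v \<tau> t s = w \<tau> t s"
  proof (cases "t \<in> {0..T} \<and> s \<in> {0..T}")
    case True
    let ?d = "\<lambda>t s. v \<tau> t s - w \<tau> t s"
    have "\<bar>?d t s\<bar> \<le> 0 / (2 powr z - 2) * \<bar>t - s\<bar> powr z"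
    proof (rule bound_by_midpoint_defect[OF z order_refl])
      show "\<bar>?d t s\<bar> \<le> (2 * K) * \<bar>t - s\<bar> powr z" if "t \<in> {0..T}" "s \<in> {0..T}" for t s
        using v_bd[OF that] w_bd[OF that] by linarith
      show "\<bar>?d t s - ?d t ((t + s) / 2) - ?d ((t + s) / 2) s\<bar> \<le> 0 * (\<bar>t - s\<bar> / 2) powr z"
        if "t \<in> {0..T}" "s \<in> {0..T}" for t s
      proof -
        have m: "(t + s) / 2 \<in> {0..T}" using that by auto
        have "delta (v \<tau>) t ((t + s) / 2) s = delta (w \<tau>) t ((t + s) / 2) s"
          using chen_treeD[OF v(2) that(1) m that(2)] chen_treeD[OF w(2) that(1) m that(2)]
            red_coproduct_forest_incr_cong[of \<tau> v w, OF eq] by simp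
        then show ?thesis by (simp add: delta_def)
      qed
    qed (use True in auto)
    then show ?thesis by simp
  next
    case False
    then show ?thesis using v w by (auto simp: C2_def)
  qed
qed

section \<open>The extension theorem\<close>

text \<open>All trees with one more vertex are treated at once, since their Chen relations involve
  only smaller trees. Successive stages keep the values already fixed, so they fit together into one
  family.\<close>

lemma extend_tree_incrs:
  fixes v :: "'l tree \<Rightarrow> incr"
  assumes T: "T > 0" and \<gamma>: "\<gamma> > 0" and A: "A \<ge> 0" and B: "0 \<le> B" "B \<le> 1"
    and n: "\<gamma> * real (n + 1) > 1"
  defines "good \<equiv> \<lambda>v \<tau>. v \<tau> \<in> C2 T \<and> chen_tree T v \<tau> \<and> (\<forall>t\<in>{0..T}. \<forall>s\<in>{0..T}.
      \<bar>v \<tau> t s\<bar> \<le> B * A ^ nverts \<tau> * q_tree \<gamma> \<tau> * \<bar>t - s\<bar> powr (\<gamma> * real (nverts \<tau>)))"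
  assumes v: "\<And>\<tau>. nverts \<tau> \<le> n \<Longrightarrow> good v \<tau>"
  shows "\<exists>w. (\<forall>\<tau>. nverts \<tau> \<le> n \<longrightarrow> w \<tau> = v \<tau>) \<and> (\<forall>\<tau>. good w \<tau>)"
proof -
  have good_cong: "good v \<tau> = good w \<tau>" if "\<And>\<sigma>. nverts \<sigma> \<le> nverts \<tau> \<Longrightarrow> v \<sigma> = w \<sigma>"
    for v w :: "'l tree \<Rightarrow> incr" and \<tau>
    using that[of \<tau>] chen_tree_cong[of \<tau> v w T, OF that] by (simp add: good_def)
  have step: "\<exists>w. (\<forall>\<tau>. nverts \<tau> \<le> n + Suc k \<longrightarrow> good w \<tau>) \<and> (\<forall>\<tau>. nverts \<tau> \<le> n + k \<longrightarrow> w \<tau> = v \<tau>)"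
    if v: "\<forall>\<tau>. nverts \<tau> \<le> n + k \<longrightarrow> good v \<tau>" for v :: "'l tree \<Rightarrow> incr" and k
  proof -
    have "\<exists>g. good (v(\<tau> := g)) \<tau>" if \<tau>: "nverts \<tau> = n + Suc k" for \<tau>
    proof -
      have "\<gamma> * real (n + 1) \<le> \<gamma> * real (nverts \<tau>)"
        using \<gamma> \<tau> by (intro mult_left_mono) auto
      then have "\<gamma> * real (nverts \<tau>) > 1" using n by linarith
      then have "\<exists>g\<in>C2 T. chen_tree T (v(\<tau> := g)) \<tau> \<and> (\<forall>t\<in>{0..T}. \<forall>s\<in>{0..T}.
          \<bar>g t s\<bar> \<le> B * A ^ nverts \<tau> * q_tree \<gamma> \<tau> * \<bar>t - s\<bar> powr (\<gamma> * real (nverts \<tau>)))"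
        using v \<tau> by (intro extend_to_tree[OF T \<gamma> A B]) (auto simp: good_def)
      then show ?thesis by (auto simp: good_def)
    qed
    then obtain g where g: "\<And>\<tau>. nverts \<tau> = n + Suc k \<Longrightarrow> good (v(\<tau> := g \<tau>)) \<tau>" by metis
    define w where "w \<tau> = (if nverts \<tau> = n + Suc k then g \<tau> else v \<tau>)" for \<tau>
    have "good w \<tau>" if "nverts \<tau> \<le> n + Suc k" for \<tau>
    proof (cases "nverts \<tau> = n + Suc k")
      case True
      \<comment> \<open>\<open>w\<close> and \<open>v(\<tau> := g \<tau>)\<close> may differ at other trees with as many vertices as \<open>\<tau>\<close>.\<close>
      have "chen_tree T w \<tau> = chen_tree T (v(\<tau> := g \<tau>)) \<tau>"
      proof -
        have "lin_ext (\<lambda>(F, G). forest_incr w t u F * forest_incr w u s G) (red_coproduct (basis_elt {#\<tau>#})) =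
            lin_ext (\<lambda>(F, G). forest_incr (v(\<tau> := g \<tau>)) t u F * forest_incr (v(\<tau> := g \<tau>)) u s G)
              (red_coproduct (basis_elt {#\<tau>#}))" for t u s
          using True by (intro red_coproduct_forest_incr_cong) (auto simp: w_def)
        then show ?thesis using True by (simp only: chen_tree_def) (simp add: w_def)
      qed
      then show ?thesis using g[OF True] True by (simp add: good_def w_def)
    next
      case False
      have "good w \<tau> = good v \<tau>"
        using False that by (intro good_cong) (auto simp: w_def)
      then show ?thesis using v False that by simp
    qed
    then show ?thesis by (intro exI[of _ w]) (auto simp: w_def)
  qed
  \<comment> \<open>The clause for \<open>k = 0\<close> anchors the chain of choices at the given
    \<open>v\<close>.\<close>
  have "\<exists>V. \<forall>k. ((\<forall>\<tau>. nverts \<tau> \<le> n + k \<longrightarrow> good (V k) \<tau>) \<and> (k = 0 \<longrightarrow> V k = v)) \<and>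
      (\<forall>\<tau>. nverts \<tau> \<le> n + k \<longrightarrow> V (Suc k) \<tau> = V k \<tau>)"
  proof (rule dependent_nat_choice)
    show "\<exists>w. (\<forall>\<tau>. nverts \<tau> \<le> n + 0 \<longrightarrow> good w \<tau>) \<and> (0 = (0::nat) \<longrightarrow> w = v)"
      using v by auto
    show "\<exists>w'. ((\<forall>\<tau>. nverts \<tau> \<le> n + Suc k \<longrightarrow> good w' \<tau>) \<and> (Suc k = 0 \<longrightarrow> w' = v)) \<and>
        (\<forall>\<tau>. nverts \<tau> \<le> n + k \<longrightarrow> w' \<tau> = w \<tau>)"
      if "(\<forall>\<tau>. nverts \<tau> \<le> n + k \<longrightarrow> good w \<tau>) \<and> (k = 0 \<longrightarrow> w = v)" for w k
      using step[of k w] that by blast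
  qed
  then obtain V where V: "\<And>k \<tau>. nverts \<tau> \<le> n + k \<Longrightarrow> good (V k) \<tau>" and V0: "V 0 = v"
    and VS: "\<And>k \<tau>. nverts \<tau> \<le> n + k \<Longrightarrow> V (Suc k) \<tau> = V k \<tau>"
    by blast
  have stable: "V (k + j) \<tau> = V k \<tau>" if "nverts \<tau> \<le> n + k" for k j \<tau>
    using that VS by (induction j) auto
  \<comment> \<open>Stage \<open>nverts \<tau>\<close> is late enough for \<tau>, since it covers
    all trees with up to \<open>n + nverts \<tau>\<close> vertices.\<close>
  define w where "w \<tau> = V (nverts \<tau>) \<tau>" for \<tau>
  have wV: "w \<tau> = V k \<tau>" if "nverts \<tau> \<le> n + k" for \<tau> k
    using stable[of \<tau> k "nverts \<tau>"] stable[of \<tau> "nverts \<tau>" k] that by (simp add: w_def add.commute)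
  have "good w \<tau>" for \<tau>
  proof -
    have "good w \<tau> = good (V (nverts \<tau>)) \<tau>" by (intro good_cong wV) auto
    then show ?thesis using V by simp
  qed
  moreover have "w \<tau> = v \<tau>" if "nverts \<tau> \<le> n" for \<tau>
    using wV[of \<tau> 0] V0 that by simp
  ultimately show ?thesis by blast
qed

theorem theorem7p3:
  fixes T \<gamma> A B :: real and n :: nat
    and X :: "('l::finite) alg \<Rightarrow> incr"
  assumes "T > 0" and "0 < \<gamma>" and "\<gamma> \<le> 1" and "A \<ge> 0" and "0 \<le> B" and "B \<le> 1"
    and "n \<ge> 1" and "\<gamma> * real (n + 1) > 1"
    and "partial_homomorphism T n X"
    and "chen_on T (alg_upto n) X"
    and "\<And>\<tau>. nverts \<tau> \<le> n \<Longrightarrow>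
           hoelder_norm T (\<gamma> * real (nverts \<tau>)) (X (basis_elt {#\<tau>#}))
             \<le> ereal (B * A ^ nverts \<tau> * q_tree \<gamma> \<tau>)"
  shows "\<exists>!Y. (\<forall>x\<in>alg_upto n. Y x = X x) \<and> branched_rough_path T \<gamma> Y \<and>
           (\<forall>\<tau>. hoelder_norm T (\<gamma> * real (nverts \<tau>)) (Y (basis_elt {#\<tau>#}))
             \<le> ereal (B * A ^ nverts \<tau> * q_tree \<gamma> \<tau>))"
proof -
  note T = assms(1) and \<gamma> = assms(2) and A = assms(4) and B = assms(5,6) and n = assms(8)
    and X = assms(9)
  let ?v = "\<lambda>\<tau>. X (basis_elt {#\<tau>#})"
  have tree_in: "basis_elt {#\<tau>#} \<in> alg_upto m" if "nverts \<tau> \<le> m" for \<tau> :: "'l tree" and m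
    using that by (intro basis_in_alg_upto) simp
  have C2_tree: "Y (basis_elt {#\<tau>#}) \<in> C2 T"
    if "partial_homomorphism T m Y" "nverts \<tau> \<le> m" for Y m and \<tau> :: "'l tree"
    using that tree_in by (auto simp: hom_on_def)
  have "\<exists>w. (\<forall>\<tau>. nverts \<tau> \<le> n \<longrightarrow> w \<tau> = ?v \<tau>) \<and>
      (\<forall>\<tau>. w \<tau> \<in> C2 T \<and> chen_tree T w \<tau> \<and> (\<forall>t\<in>{0..T}. \<forall>s\<in>{0..T}.
        \<bar>w \<tau> t s\<bar> \<le> B * A ^ nverts \<tau> * q_tree \<gamma> \<tau> * \<bar>t - s\<bar> powr (\<gamma> * real (nverts \<tau>))))"
    using C2_tree[OF X] chen_tree_of_hom[OF X assms(10)] C2_hoelder_bound assms(11)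
    by (intro extend_tree_incrs[OF T \<gamma> A B n] conjI ballI) blast+
  then obtain w where w_eq: "\<And>\<tau>. nverts \<tau> \<le> n \<Longrightarrow> w \<tau> = ?v \<tau>"
    and w_C2: "\<And>\<tau>. w \<tau> \<in> C2 T" and w_chen: "\<And>\<tau>. chen_tree T w \<tau>"
    and w_bd: "\<And>\<tau> t s. t \<in> {0..T} \<Longrightarrow> s \<in> {0..T} \<Longrightarrow>
      \<bar>w \<tau> t s\<bar> \<le> B * A ^ nverts \<tau> * q_tree \<gamma> \<tau> * \<bar>t - s\<bar> powr (\<gamma> * real (nverts \<tau>))"
    by blast
  let ?W = "tree_hom T w"
  have W: "homomorphism T ?W" by (rule homomorphism_tree_hom[OF w_C2])
  have W_bd: "hoelder_norm T (\<gamma> * real (fdeg F)) (?W (basis_elt F)) \<le> ereal (B * A ^ fdeg F * q_forest \<gamma> F)"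
    if "F \<noteq> {#}" for F
    unfolding hoelder_norm_le_iff
  proof (intro ballI impI)
    fix t s assume ts: "t \<in> {0..T}" "s \<in> {0..T}"
    have "\<bar>forest_incr w t s F\<bar> \<le> B * A ^ fdeg F * q_forest \<gamma> F * \<bar>t - s\<bar> powr (\<gamma> * real (fdeg F))"
      by (rule forest_incr_bound[OF \<gamma> A B that]) (rule w_bd[OF ts])
    then show "\<bar>?W (basis_elt F) t s\<bar> \<le>
        B * A ^ fdeg F * q_forest \<gamma> F * \<bar>t - s\<bar> powr (\<gamma> * real (fdeg F))"
      using ts by (simp add: tree_hom_def)
  qed
  show ?thesis
  proof (rule ex1I[of _ ?W])
    have "?W x = X x" if "x \<in> alg_upto n" for x
      by (rule hom_on_eqI[OF hom_on_subset[OF W subset_UNIV] X _ that])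
        (simp add: tree_hom_tree[OF w_C2] w_eq)
    moreover have "branched_rough_path T \<gamma> ?W"
      unfolding branched_rough_path_def using W chen_on_tree_hom[OF w_chen] W_bd A B by blast
    moreover have "hoelder_norm T (\<gamma> * real (nverts \<tau>)) (?W (basis_elt {#\<tau>#}))
        \<le> ereal (B * A ^ nverts \<tau> * q_tree \<gamma> \<tau>)" for \<tau>
      using W_bd[of "{#\<tau>#}"] by (simp add: q_forest_def)
    ultimately show "(\<forall>x\<in>alg_upto n. ?W x = X x) \<and> branched_rough_path T \<gamma> ?W \<and>
        (\<forall>\<tau>. hoelder_norm T (\<gamma> * real (nverts \<tau>)) (?W (basis_elt {#\<tau>#}))
          \<le> ereal (B * A ^ nverts \<tau> * q_tree \<gamma> \<tau>))" by blast
  next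
    fix Y
    assume "(\<forall>x\<in>alg_upto n. Y x = X x) \<and> branched_rough_path T \<gamma> Y \<and>
        (\<forall>\<tau>. hoelder_norm T (\<gamma> * real (nverts \<tau>)) (Y (basis_elt {#\<tau>#}))
          \<le> ereal (B * A ^ nverts \<tau> * q_tree \<gamma> \<tau>))"
    then have Y_eq: "\<And>x. x \<in> alg_upto n \<Longrightarrow> Y x = X x" and Y: "homomorphism T Y"
      and Y_chen: "chen_on T UNIV Y"
      and Y_bd: "\<And>\<tau>. hoelder_norm T (\<gamma> * real (nverts \<tau>)) (Y (basis_elt {#\<tau>#}))
          \<le> ereal (B * A ^ nverts \<tau> * q_tree \<gamma> \<tau>)"
      unfolding branched_rough_path_def by blast+
    let ?u = "\<lambda>\<tau>. Y (basis_elt {#\<tau>#})"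
    have u_C2: "?u \<tau> \<in> C2 T" for \<tau> using Y by (simp add: hom_on_def)
    \<comment> \<open>The degree of \<tau> itself is taken as the truncation level.\<close>
    have u_chen: "chen_tree T ?u \<tau>" for \<tau>
      by (rule chen_tree_of_hom[OF hom_on_subset[OF Y subset_UNIV] _ order_refl])
        (use Y_chen in \<open>simp add: chen_on_def\<close>)
    \<comment> \<open>Up to \<open>n\<close> vertices both families restrict to \<open>X\<close>;
      beyond that the exponent exceeds 1 and uniqueness at a single tree applies.\<close>
    have uw: "?u \<tau> = w \<tau>" for \<tau>
    proof (induction "nverts \<tau>" arbitrary: \<tau> rule: less_induct)
      case less
      show ?case
      proof (cases "nverts \<tau> \<le> n")
        case True
        then show ?thesis using Y_eq[OF tree_in] w_eq by simp
      next
        case False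
        then have "\<gamma> * real (n + 1) \<le> \<gamma> * real (nverts \<tau>)" using \<gamma> by (intro mult_left_mono) auto
        then have large: "\<gamma> * real (nverts \<tau>) > 1" using n by linarith
        show ?thesis
          by (rule tree_incr_unique[where v = ?u and w = w, OF u_C2 u_chen w_C2 w_chen less large
                C2_hoelder_bound[OF u_C2 Y_bd] w_bd])
      qed
    qed
    show "Y = ?W"
    proof
      fix x :: "'l alg"
      \<comment> \<open>Each element has finite support, so equality on trees can be lifted inside
        one truncation.\<close>
      obtain m where "x \<in> alg_upto m" using ex_alg_upto by blast
      then show "Y x = ?W x"
        by (rule hom_on_eqI[OF hom_on_subset[OF Y subset_UNIV] hom_on_subset[OF W subset_UNIV], rotated])
          (simp add: tree_hom_tree[OF w_C2] uw)
    qed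
  qed
qed

end
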